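(* Let $\mathcal{F}_2$ be the Fock space. (1) Let $\psi$ be an entire function such that the composition operator $C_\psi f=f\circ\psi$ is bounded on $\mathcal{F}_2$, that is, $\psi(z)=az+b$ with $a,b\in\mathbb{C}$, $|a|\le 1$, and $b=0$ whenever $|a|=1$. Then $C_\psi$ is cyclic on $\mathcal{F}_2$ if and only if $a^k\neq a$ for each positive integer $k\ge 2$. In this case, the reproducing kernel $K_z$ is a cyclic vector. (2) For $\psi$ such that $C_\psi$ is bounded on $\mathcal{F}_2$, the operator $C_\psi$ is not supercyclic on $\mathcal{F}_2$. (3) There exists no cyclic multiplication operator on $\mathcal{F}_2$; that is, for every entire function $u$ such that $M_uf=uf$ is bounded on $\mathcal{F}_2$, the operator $M_u$ is not cyclic on $\mathcal{F}_2$.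
   Context: The Fock space $\mathcal{F}_2$ is the Hilbert space of entire functions $f:\mathbb{C}\to\mathbb{C}$ that are square integrable with respect to the Gaussian measure $d\mu(z)=\frac{1}{\pi}e^{-|z|^2}\,dA(z)$, where $dA$ is Lebesgue measure on $\mathbb{C}$, with inner product $\langle f,g\rangle=\int_{\mathbb{C}}f\overline{g}\,d\mu$. Its reproducing kernel at a point $z\in\mathbb{C}$ is the function $K_z(w)=e^{w\overline{z}}$. An operator $C_\psi$ or $M_u$ is bounded on $\mathcal{F}_2$ if it maps $\mathcal{F}_2$ into itself and is a bounded linear operator there. A bounded linear operator $T$ on a separable Banach space $\mathcal{H}$ is cyclic if there is a vector $f\in\mathcal{H}$ (called a cyclic vector for $T$) such that the linear span of the orbit $\{f,Tf,T^2f,\dots\}$ is dense in $\mathcal{H}$; it is supercyclic if there is a vector $f\in\mathcal{H}$ such that the projective orbit $\{\lambda T^nf:\lambda\in\mathbb{C},\ n=0,1,2,\dots\}$ is dense in $\mathcal{H}$.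
   Formalization: The claim that the reproducing kernel K_z is a cyclic vector is proved for every z ≠ 0; the point z = 0 is excluded because K_0 = 1 is fixed by every composition operator and so is never cyclic. *)

theory Defs
  imports "HOL-Analysis.Analysis" "HOL-Library.Function_Algebras"
begin

section \<open>The Fock space\<close>

definition gauss_measure :: "complex measure" where
  "gauss_measure = density lborel (\<lambda>z. ennreal (exp (- (cmod z)\<^sup>2) / pi))"

definition fock :: "(complex \<Rightarrow> complex) set" where
  "fock = {f. f holomorphic_on UNIV \<and> integrable gauss_measure (\<lambda>z. (cmod (f z))\<^sup>2)}"

definition fock_inner :: "(complex \<Rightarrow> complex) \<Rightarrow> (complex \<Rightarrow> complex) \<Rightarrow> complex" where
  "fock_inner f g = (LINT z|gauss_measure. f z * cnj (g z))"

definition fock_norm :: "(complex \<Rightarrow> complex) \<Rightarrow> real" where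
  "fock_norm f = sqrt (Re (fock_inner f f))"

definition fock_dist :: "(complex \<Rightarrow> complex) \<Rightarrow> (complex \<Rightarrow> complex) \<Rightarrow> real" where
  "fock_dist f g = fock_norm (f - g)"

definition fock_kernel :: "complex \<Rightarrow> complex \<Rightarrow> complex" where
  "fock_kernel z w = exp (w * cnj z)"

definition cscale :: "complex \<Rightarrow> (complex \<Rightarrow> complex) \<Rightarrow> complex \<Rightarrow> complex" where
  "cscale c f = (\<lambda>z. c * f z)"

interpretation cfun: vector_space cscale
  by unfold_locales (auto simp: cscale_def algebra_simps)

lemma sets_gauss_measure [simp, measurable_cong]: "sets gauss_measure = sets borel"
  by (simp add: gauss_measure_def)

lemma space_gauss_measure [simp]: "space gauss_measure = UNIV"
  by (simp add: gauss_measure_def)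

lemma holomorphic_imp_borel_measurable:
  "f holomorphic_on UNIV \<Longrightarrow> f \<in> borel_measurable (borel :: complex measure)"
  by (intro borel_measurable_continuous_onI holomorphic_on_imp_continuous_on)

lemma fock_norm_eq: "fock_norm f = sqrt (LINT z|gauss_measure. (cmod (f z))\<^sup>2)"
proof -
  have "fock_inner f f = (LINT z|gauss_measure. complex_of_real ((cmod (f z))\<^sup>2))"
    unfolding fock_inner_def by (simp add: complex_norm_square del: of_real_power)
  then show ?thesis
    by (simp add: fock_norm_def del: of_real_power)
qed

lemma fock_norm_nonneg: "fock_norm f \<ge> 0"
  by (simp add: fock_norm_eq)

lemma fock_norm_power2: "(fock_norm f)\<^sup>2 = (LINT z|gauss_measure. (cmod (f z))\<^sup>2)"
  by (simp add: fock_norm_eq)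

lemma cmod_add_power2_le:
  assumes "c > 0"
  shows "(cmod (x + y))\<^sup>2 \<le> (1 + c) * (cmod x)\<^sup>2 + (1 + 1 / c) * (cmod y)\<^sup>2"
proof -
  have "0 \<le> (sqrt c * cmod x - cmod y / sqrt c)\<^sup>2" by simp
  also have "\<dots> = c * (cmod x)\<^sup>2 - 2 * (cmod x * cmod y) + (cmod y)\<^sup>2 / c"
    using assms by (simp add: power2_diff power_mult_distrib power_divide)
  finally have "2 * (cmod x * cmod y) \<le> c * (cmod x)\<^sup>2 + (cmod y)\<^sup>2 / c" by simp
  moreover have "(cmod (x + y))\<^sup>2 \<le> (cmod x + cmod y)\<^sup>2"
    by (simp add: norm_triangle_ineq power_mono)
  ultimately show ?thesis
    by (simp add: power2_sum algebra_simps)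
qed

lemma fock_add_closed:
  assumes "f \<in> fock" "g \<in> fock"
  shows "f + g \<in> fock"
proof -
  have hol: "(\<lambda>z. f z + g z) holomorphic_on UNIV"
    using assms by (auto simp: fock_def intro: holomorphic_intros)
  have "integrable gauss_measure (\<lambda>z. (cmod (f z + g z))\<^sup>2)"
  proof (rule Bochner_Integration.integrable_bound)
    show "integrable gauss_measure (\<lambda>z. (1 + 1) * (cmod (f z))\<^sup>2 + (1 + 1 / 1) * (cmod (g z))\<^sup>2)"
      using assms by (auto simp: fock_def)
    show "(\<lambda>z. (cmod (f z + g z))\<^sup>2) \<in> borel_measurable gauss_measure"
      using holomorphic_imp_borel_measurable[OF hol] by measurable
    show "AE z in gauss_measure. norm ((cmod (f z + g z))\<^sup>2)
        \<le> norm ((1 + 1) * (cmod (f z))\<^sup>2 + (1 + 1 / 1) * (cmod (g z))\<^sup>2)"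
      using cmod_add_power2_le[of 1] by auto
  qed
  with hol show ?thesis by (simp add: fock_def plus_fun_def)
qed

lemma fock_scale_closed: "f \<in> fock \<Longrightarrow> cscale c f \<in> fock"
  by (auto simp: fock_def cscale_def norm_mult power_mult_distrib intro: holomorphic_intros)

lemma fock_subspace: "cfun.subspace fock"
  unfolding cfun.subspace_def
  using fock_add_closed fock_scale_closed by (auto simp: fock_def zero_fun_def)

lemma fock_norm_zero: "fock_norm 0 = 0"
  by (simp add: fock_norm_eq)

lemma fock_norm_zero_imp:
  assumes "f \<in> fock" "fock_norm f = 0"
  shows "f = 0"
proof -
  have hol: "f holomorphic_on UNIV" and int: "integrable gauss_measure (\<lambda>z. (cmod (f z))\<^sup>2)"
    using assms by (auto simp: fock_def)
  have "AE z in gauss_measure. (cmod (f z))\<^sup>2 = 0"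
    using assms(2) integral_nonneg_eq_0_iff_AE[OF int] by (simp add: fock_norm_eq)
  then have "AE z in lborel. f z = 0"
    unfolding gauss_measure_def by (subst (asm) AE_density) auto
  moreover have op: "open {z. f z \<noteq> 0}"
    using hol by (intro open_Collect_neq holomorphic_on_imp_continuous_on continuous_on_const)
  ultimately have "{z. f z \<noteq> 0} \<in> null_sets lborel"
    using AE_iff_null_sets[of "{z. f z \<noteq> 0}" lborel] by simp
  then have "negligible {z. f z \<noteq> 0}"
    by (simp add: negligible_iff_null_sets null_sets_completionI)
  with op have "{z. f z \<noteq> 0} = {}"
    using open_not_negligible by blast
  then show ?thesis by (auto simp: fun_eq_iff)
qed

lemma fock_norm_triangle:
  assumes "f \<in> fock" "g \<in> fock"
  shows "fock_norm (f + g) \<le> fock_norm f + fock_norm g"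
proof (cases "fock_norm f = 0 \<or> fock_norm g = 0")
  case True
  then have "f = 0 \<or> g = 0"
    using assms fock_norm_zero_imp by blast
  then show ?thesis
    by (elim disjE) (simp_all add: fock_norm_zero)
next
  case False
  define A B where "A = fock_norm f" and "B = fock_norm g"
  have pos: "A > 0" "B > 0"
    using False fock_norm_nonneg[of f] fock_norm_nonneg[of g] by (auto simp: A_def B_def)
  have intf: "integrable gauss_measure (\<lambda>z. (cmod (f z))\<^sup>2)"
   and intg: "integrable gauss_measure (\<lambda>z. (cmod (g z))\<^sup>2)"
   and intfg: "integrable gauss_measure (\<lambda>z. (cmod (f z + g z))\<^sup>2)"
    using assms fock_add_closed[OF assms] by (auto simp: fock_def plus_fun_def)
  have "(fock_norm (f + g))\<^sup>2
      \<le> (LINT z|gauss_measure. (1 + B / A) * (cmod (f z))\<^sup>2 + (1 + 1 / (B / A)) * (cmod (g z))\<^sup>2)"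
    unfolding fock_norm_power2 plus_fun_apply
  proof (rule integral_mono)
    show "integrable gauss_measure
        (\<lambda>z. (1 + B / A) * (cmod (f z))\<^sup>2 + (1 + 1 / (B / A)) * (cmod (g z))\<^sup>2)"
      using intf intg by auto
    show "(cmod (f z + g z))\<^sup>2
        \<le> (1 + B / A) * (cmod (f z))\<^sup>2 + (1 + 1 / (B / A)) * (cmod (g z))\<^sup>2" for z
      using pos by (intro cmod_add_power2_le) auto
  qed (use intfg in auto)
  also have "\<dots> = (1 + B / A) * A\<^sup>2 + (1 + 1 / (B / A)) * B\<^sup>2"
    using intf intg by (simp add: A_def B_def fock_norm_power2)
  also have "\<dots> = (A + B)\<^sup>2"
    using pos by (simp add: field_simps power2_eq_square)
  finally have "fock_norm (f + g) \<le> A + B"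
    by (rule power2_le_imp_le) (use pos in simp)
  then show ?thesis
    by (simp add: A_def B_def)
qed

interpretation fock: Metric_space fock fock_dist
proof
  fix f g h
  show "0 \<le> fock_dist f g"
    by (simp add: fock_dist_def fock_norm_nonneg)
  show "fock_dist f g = fock_dist g f"
    by (simp add: fock_dist_def fock_norm_eq norm_minus_commute)
  assume f: "f \<in> fock" and g: "g \<in> fock"
  show "fock_dist f g = 0 \<longleftrightarrow> f = g"
    using fock_norm_zero_imp[OF cfun.subspace_diff[OF fock_subspace f g]]
    by (auto simp: fock_dist_def fock_norm_zero)
  assume h: "h \<in> fock"
  show "fock_dist f h \<le> fock_dist f g + fock_dist g h"
    using fock_norm_triangle[OF cfun.subspace_diff[OF fock_subspace f g]
        cfun.subspace_diff[OF fock_subspace g h]]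
    by (simp add: fock_dist_def)
qed

section \<open>Operators\<close>

text \<open>Operators are represented by maps on all functions from the complex numbers to themselves;
  only their restriction to the Fock space matters.\<close>

definition comp_op :: "(complex \<Rightarrow> complex) \<Rightarrow> (complex \<Rightarrow> complex) \<Rightarrow> complex \<Rightarrow> complex" where
  "comp_op \<psi> f = f \<circ> \<psi>"

definition mult_op :: "(complex \<Rightarrow> complex) \<Rightarrow> (complex \<Rightarrow> complex) \<Rightarrow> complex \<Rightarrow> complex" where
  "mult_op u f = (\<lambda>z. u z * f z)"

definition fock_bounded :: "((complex \<Rightarrow> complex) \<Rightarrow> complex \<Rightarrow> complex) \<Rightarrow> bool" where
  "fock_bounded T \<longleftrightarrow>
     T \<in> fock \<rightarrow> fock \<and>
     (\<forall>f\<in>fock. \<forall>g\<in>fock. T (f + g) = T f + T g) \<and>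
     (\<forall>c. \<forall>f\<in>fock. T (cscale c f) = cscale c (T f)) \<and>
     (\<exists>C. \<forall>f\<in>fock. fock_norm (T f) \<le> C * fock_norm f)"

definition fock_dense :: "(complex \<Rightarrow> complex) set \<Rightarrow> bool" where
  "fock_dense S \<longleftrightarrow> S \<subseteq> fock \<and> fock.mtopology closure_of S = fock"

definition cyclic_vector ::
  "((complex \<Rightarrow> complex) \<Rightarrow> complex \<Rightarrow> complex) \<Rightarrow> (complex \<Rightarrow> complex) \<Rightarrow> bool" where
  "cyclic_vector T f \<longleftrightarrow> f \<in> fock \<and> fock_dense (cfun.span (range (\<lambda>n. (T ^^ n) f)))"

definition cyclic :: "((complex \<Rightarrow> complex) \<Rightarrow> complex \<Rightarrow> complex) \<Rightarrow> bool" where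
  "cyclic T \<longleftrightarrow> (\<exists>f. cyclic_vector T f)"

definition supercyclic :: "((complex \<Rightarrow> complex) \<Rightarrow> complex \<Rightarrow> complex) \<Rightarrow> bool" where
  "supercyclic T \<longleftrightarrow> (\<exists>f\<in>fock. fock_dense {cscale c ((T ^^ n) f) | c n. True})"

end

(* Rotation invariance of the Gaussian measure makes the monomials orthogonal, so a Fock function
   with Taylor coefficients c_k satisfies ||f||^2 = sum |c_k|^2 ||z^k||^2. Together with the Weyl
   translations f(z) |-> f(z + w) exp(- z cnj w) this gives the pointwise bound
   |f(z)| ||1|| <= exp(|z|^2 / 2) ||f||, attained up to a constant by the kernel at z.
   Testing a bounded operator on kernels and applying Liouville's theorem shows that psi is affine
   with |psi(z)|^2 <= |z|^2 + const, and that a bounded multiplier is constant.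
   Cyclicity of kernels: the orbit of K_z consists of multiples of exp(a^n cnj z w), whose Taylor
   coefficients are separated by the distinct numbers a^k, so every monomial lies in the closed span.
   The negative statements come from closed relations between point evaluations or Taylor
   coefficients that hold on the orbit but not on all polynomials. *)
theory Submission
  imports Defs "HOL-Complex_Analysis.Complex_Analysis" "HOL-Probability.Distributions"
begin

section \<open>Rotation invariance of the Gaussian measure\<close>

text \<open>Neither the norms of the monomials nor the mass of the Gaussian measure is computed:
  finiteness and positivity suffice, and \<open>fock_norm (\<lambda>_. 1)\<close> cancels or is
  absorbed into a constant. Rotations are built from shears because Fubini reduces a shear to a
  translation of the real line. The obstacle in Parseval's identity is that an entire function need
  not be square integrable and that its series converges uniformly only on discs. Orthogonality is
  therefore proved with a cutoff to a disc, and the identity is stated for all entire functions in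
  the extended nonnegative reals, so that it decides membership as well as the norm. Norm
  approximation then becomes a question about coefficients, settled by dominated convergence for the
  Parseval series. An affine symbol with the stated bounds has a fixed point p, and centring at p
  turns its iterates into dilations; this is how b nonzero is handled for supercyclicity and for the
  kernels.\<close>

lemma nn_integral_lborel_complex:
  fixes F :: "complex \<Rightarrow> ennreal"
  assumes [measurable]: "F \<in> borel_measurable borel"
  shows "(\<integral>\<^sup>+z. F z \<partial>lborel) = (\<integral>\<^sup>+y. \<integral>\<^sup>+x. F (Complex x y) \<partial>lborel \<partial>lborel)"
proof -
  have [measurable]: "(\<lambda>p::real \<times> real. Complex (fst p) (snd p)) \<in> borel_measurable borel"
    by (intro borel_measurable_continuous_onI continuous_intros)
  \<comment> \<open>Lebesgue measure is determined by its values on boxes, and a box in the complex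
    plane pulls back to a box of pairs.\<close>
  have *: "lborel = distr (lborel :: (real \<times> real) measure) borel (\<lambda>p. Complex (fst p) (snd p))"
  proof (rule lborel_eqI)
    fix l u :: complex
    assume le: "\<And>b. b \<in> Basis \<Longrightarrow> l \<bullet> b \<le> u \<bullet> b"
    have re: "Re l \<le> Re u" "Im l \<le> Im u"
      using le[of 1] le[of \<i>] by (auto simp: Basis_complex_def)
    have eq: "(\<lambda>p. Complex (fst p) (snd p)) -` box l u = box (Re l, Im l) (Re u, Im u)"
      by (auto simp: in_box_complex_iff box_def Basis_prod_def Basis_complex_def)
    have "emeasure (distr lborel borel (\<lambda>p. Complex (fst p) (snd p))) (box l u)
        = emeasure lborel (box (Re l, Im l) (Re u, Im u))"
      by (subst emeasure_distr) (auto simp: eq)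
    also have "\<dots> = (\<Prod>b\<in>Basis. (u - l) \<bullet> b)"
      using re
      by (subst emeasure_lborel_box)
         (auto simp: Basis_prod_def Basis_complex_def prod.union_disjoint prod.reindex inj_on_def)
    finally show "emeasure (distr lborel borel (\<lambda>p. Complex (fst p) (snd p))) (box l u)
        = (\<Prod>b\<in>Basis. (u - l) \<bullet> b)" .
  qed simp
  have "(\<integral>\<^sup>+z. F z \<partial>lborel) = (\<integral>\<^sup>+p. F (Complex (fst p) (snd p)) \<partial>(lborel \<Otimes>\<^sub>M lborel))"
    by (subst *, subst nn_integral_distr) (auto simp: lborel_prod)
  also have "\<dots> = (\<integral>\<^sup>+y. \<integral>\<^sup>+x. F (Complex x y) \<partial>lborel \<partial>lborel)"
    by (subst lborel_pair.nn_integral_snd[symmetric]) (auto simp: split_beta' lborel_prod)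
  finally show ?thesis .
qed

lemma nn_integral_lborel_shift_complex:
  fixes F :: "complex \<Rightarrow> ennreal"
  assumes [measurable]: "F \<in> borel_measurable borel"
  shows "(\<integral>\<^sup>+z. F (w + z) \<partial>lborel) = (\<integral>\<^sup>+z. F z \<partial>lborel)"
  by (subst (2) lborel_distr_plus[of w, symmetric], subst nn_integral_distr) auto

text \<open>The inner integral now runs over the imaginary part, the variable that a vertical shear
  translates.\<close>

lemma nn_integral_lborel_swap_complex:
  fixes F :: "complex \<Rightarrow> ennreal"
  assumes [measurable]: "F \<in> borel_measurable borel"
  shows "(\<integral>\<^sup>+z. F z \<partial>lborel) = (\<integral>\<^sup>+x. \<integral>\<^sup>+y. F (Complex x y) \<partial>lborel \<partial>lborel)"
proof -
  have [measurable]: "(\<lambda>p::real \<times> real. Complex (fst p) (snd p)) \<in> borel_measurable borel"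
    by (intro borel_measurable_continuous_onI continuous_intros)
  show ?thesis
    unfolding nn_integral_lborel_complex[OF assms]
    by (rule lborel_pair.Fubini') (auto simp: split_beta' lborel_prod)
qed

text \<open>A rotation other than the half turn is a product of three shears.\<close>

lemma nn_integral_lborel_rotate:
  fixes F :: "complex \<Rightarrow> ennreal"
  assumes [measurable]: "F \<in> borel_measurable borel" and \<omega>: "cmod \<omega> = 1" "Re \<omega> \<noteq> -1"
  shows "(\<integral>\<^sup>+z. F (\<omega> * z) \<partial>lborel) = (\<integral>\<^sup>+z. F z \<partial>lborel)"
proof -
  define S1 S2 :: "real \<Rightarrow> complex \<Rightarrow> complex"
    where "S1 = (\<lambda>t z. Complex (Re z + t * Im z) (Im z))"
      and "S2 = (\<lambda>t z. Complex (Re z) (Im z + t * Re z))"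
  have [measurable]: "S1 t \<in> borel_measurable borel" "S2 t \<in> borel_measurable borel" for t
    unfolding S1_def S2_def
    by (intro borel_measurable_continuous_onI continuous_intros)+
  have [measurable]: "(\<lambda>x. Complex x y) \<in> borel_measurable borel"
       "(\<lambda>y. Complex x y) \<in> borel_measurable borel" for x y
    by (intro borel_measurable_continuous_onI continuous_intros)+
  have shift: "(\<integral>\<^sup>+x. H (x + t) \<partial>lborel) = (\<integral>\<^sup>+x. H x \<partial>lborel)"
    if "H \<in> borel_measurable borel" for H :: "real \<Rightarrow> ennreal" and t
    using nn_integral_real_affine[OF that, of 1 t] by (simp add: add.commute)
  have 1: "(\<integral>\<^sup>+z. G (S1 t z) \<partial>lborel) = (\<integral>\<^sup>+z. G z \<partial>lborel)"
    if [measurable]: "G \<in> borel_measurable borel" for G :: "complex \<Rightarrow> ennreal" and t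
  proof -
    have "(\<integral>\<^sup>+z. G (S1 t z) \<partial>lborel)
        = (\<integral>\<^sup>+y. \<integral>\<^sup>+x. G (Complex (x + t * y) y) \<partial>lborel \<partial>lborel)"
      by (subst nn_integral_lborel_complex) (measurable, simp add: S1_def)
    also have "\<dots> = (\<integral>\<^sup>+y. \<integral>\<^sup>+x. G (Complex x y) \<partial>lborel \<partial>lborel)"
      by (intro nn_integral_cong shift) measurable
    finally show ?thesis by (simp add: nn_integral_lborel_complex)
  qed
  have 2: "(\<integral>\<^sup>+z. G (S2 t z) \<partial>lborel) = (\<integral>\<^sup>+z. G z \<partial>lborel)"
    if [measurable]: "G \<in> borel_measurable borel" for G :: "complex \<Rightarrow> ennreal" and t
  proof -
    have "(\<integral>\<^sup>+z. G (S2 t z) \<partial>lborel)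
        = (\<integral>\<^sup>+x. \<integral>\<^sup>+y. G (Complex x (y + t * x)) \<partial>lborel \<partial>lborel)"
      by (subst nn_integral_lborel_swap_complex) (measurable, simp add: S2_def)
    also have "\<dots> = (\<integral>\<^sup>+x. \<integral>\<^sup>+y. G (Complex x y) \<partial>lborel \<partial>lborel)"
      by (intro nn_integral_cong shift) measurable
    finally show ?thesis by (simp add: nn_integral_lborel_swap_complex)
  qed
  \<comment> \<open>For \<omega> with argument \<theta> this \<open>t\<close> is tan(\<theta>/2),
    and the rotation is the product of shears with parameters -tan(\<theta>/2), sin \<theta>,
    -tan(\<theta>/2). The denominator vanishes exactly at the half turn.\<close>
  define c s t where "c = Re \<omega>" "s = Im \<omega>" "t = s / (1 + c)"
  have cs: "c\<^sup>2 + s\<^sup>2 = 1"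
    using \<omega>(1) by (simp add: c_s_t_def cmod_def)
  have c1: "1 + c \<noteq> 0" using \<omega>(2) by (simp add: c_s_t_def)
  have ts: "t * s = 1 - c"
  proof -
    have "t * s * (1 + c) = s\<^sup>2" using c1 by (simp add: c_s_t_def(3) power2_eq_square)
    also have "\<dots> = (1 - c) * (1 + c)" using cs by (simp add: algebra_simps power2_eq_square)
    finally show ?thesis using c1 by simp
  qed
  have tc: "t * c = s - t"
    using c1 by (simp add: c_s_t_def(3) field_simps)
  have "\<omega> * z = S1 (-t) (S2 s (S1 (-t) z))" for z
  proof -
    obtain x y where z: "z = Complex x y" by (cases z)
    have i: "y + s * (x + - t * y) = s * x + c * y"
    proof -
      have "y + s * (x + - t * y) = y + s * x - (t * s) * y" by (simp add: algebra_simps)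
      then show ?thesis by (simp only: ts) (simp add: algebra_simps)
    qed
    have "(x + - t * y) + - t * (s * x + c * y) = x - t * y - (t * s) * x - (t * c) * y"
      by (simp add: algebra_simps)
    then have r: "(x + - t * y) + - t * (s * x + c * y) = c * x - s * y"
      by (simp only: ts tc) (simp add: algebra_simps)
    show ?thesis
      unfolding S1_def S2_def z complex.sel i r
      by (simp add: complex_eq_iff c_s_t_def(1,2))
  qed
  then have "(\<integral>\<^sup>+z. F (\<omega> * z) \<partial>lborel) = (\<integral>\<^sup>+z. F (S1 (-t) (S2 s (S1 (-t) z))) \<partial>lborel)"
    by simp
  also have "\<dots> = (\<integral>\<^sup>+z. F z \<partial>lborel)"
    by (subst 1[of "\<lambda>z. F (S1 (-t) (S2 s z))"], measurable)
       (subst 2[of "\<lambda>z. F (S1 (-t) z)"], measurable, rule 1, measurable)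
  finally show ?thesis .
qed

lemma nn_integral_gauss:
  assumes "F \<in> borel_measurable borel"
  shows "(\<integral>\<^sup>+z. F z \<partial>gauss_measure) = (\<integral>\<^sup>+z. ennreal (exp (- (cmod z)\<^sup>2) / pi) * F z \<partial>lborel)"
  using assms unfolding gauss_measure_def by (subst nn_integral_density) auto

text \<open>The Gaussian density depends on the modulus only, so the invariance of Lebesgue measure
  carries over.\<close>

lemma distr_gauss_rotate:
  assumes \<omega>: "cmod \<omega> = 1" "Re \<omega> \<noteq> -1"
  shows "distr gauss_measure borel ((*) \<omega>) = gauss_measure"
proof (rule measure_eqI)
  fix A assume "A \<in> sets (distr gauss_measure borel ((*) \<omega>))"
  then have [measurable]: "A \<in> sets borel" by simp
  have "emeasure (distr gauss_measure borel ((*) \<omega>)) A = (\<integral>\<^sup>+z. indicator A (\<omega> * z) \<partial>gauss_measure)"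
    by (subst nn_integral_indicator[symmetric], simp, subst nn_integral_distr) auto
  also have "\<dots> = (\<integral>\<^sup>+z. ennreal (exp (- (cmod (\<omega> * z))\<^sup>2) / pi) * indicator A (\<omega> * z) \<partial>lborel)"
    by (subst nn_integral_gauss) (auto simp: norm_mult \<omega>)
  also have "\<dots> = (\<integral>\<^sup>+z. ennreal (exp (- (cmod z)\<^sup>2) / pi) * indicator A z \<partial>lborel)"
    by (rule nn_integral_lborel_rotate[where F = "\<lambda>z. ennreal (exp (- (cmod z)\<^sup>2) / pi) * indicator A z"])
       (auto simp: \<omega>)
  also have "\<dots> = (\<integral>\<^sup>+z. indicator A z \<partial>gauss_measure)"
    by (subst nn_integral_gauss) auto
  finally show "emeasure (distr gauss_measure borel ((*) \<omega>)) A = emeasure gauss_measure A"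
    by simp
qed simp

lemma nn_integral_gaussian_complex_finite:
  assumes "c > 0"
  shows "(\<integral>\<^sup>+z. ennreal (exp (- c * (cmod z)\<^sup>2)) \<partial>lborel) < \<infinity>"
proof -
  \<comment> \<open>This standard deviation gives 1/(2 \<sigma>^2) = c, so the normal density is a
    multiple of exp(-c x^2); the complex Gaussian is a product of two such factors.\<close>
  define \<sigma> where "\<sigma> = 1 / sqrt (2 * c)"
  have \<sigma>: "\<sigma> > 0" "\<sigma>\<^sup>2 = 1 / (2 * c)" using assms by (auto simp: \<sigma>_def power_divide)
  have "integrable lborel (\<lambda>x. sqrt (2 * pi * \<sigma>\<^sup>2) * normal_density 0 \<sigma> x)"
    using \<sigma> by (intro integrable_mult_right integrable_normal_density)
  moreover have "(\<lambda>x. sqrt (2 * pi * \<sigma>\<^sup>2) * normal_density 0 \<sigma> x) = (\<lambda>x. exp (- c * x\<^sup>2))"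
    using \<sigma> assms by (auto simp: normal_density_def fun_eq_iff)
  ultimately have "integrable lborel (\<lambda>x::real. exp (- c * x\<^sup>2))" by simp
  then have fin: "(\<integral>\<^sup>+x. ennreal (exp (- c * x\<^sup>2)) \<partial>lborel) < \<infinity>"
    by (simp add: integrable_iff_bounded)
  have "(\<integral>\<^sup>+z. ennreal (exp (- c * (cmod z)\<^sup>2)) \<partial>lborel) =
      (\<integral>\<^sup>+y. \<integral>\<^sup>+x. ennreal (exp (- c * y\<^sup>2)) * ennreal (exp (- c * x\<^sup>2)) \<partial>lborel \<partial>(lborel::real measure))"
    by (subst nn_integral_lborel_complex)
       (auto simp: cmod_def exp_add[symmetric] ennreal_mult'[symmetric] algebra_simps)
  also have "\<dots> = (\<integral>\<^sup>+x. ennreal (exp (- c * x\<^sup>2)) \<partial>lborel) * (\<integral>\<^sup>+x. ennreal (exp (- c * x\<^sup>2)) \<partial>lborel)"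
    by (simp add: nn_integral_cmult nn_integral_multc)
  also have "\<dots> < \<infinity>" using fin by (simp add: ennreal_mult_less_top)
  finally show ?thesis .
qed

interpretation gauss: finite_measure gauss_measure
proof
  have "emeasure gauss_measure UNIV = (\<integral>\<^sup>+z. 1 \<partial>gauss_measure)" by simp
  also have "\<dots> = (\<integral>\<^sup>+z. ennreal (1 / pi) * ennreal (exp (- 1 * (cmod z)\<^sup>2)) \<partial>lborel)"
    by (subst nn_integral_gauss) (auto simp: ennreal_mult'[symmetric])
  also have "\<dots> < \<infinity>"
    using nn_integral_gaussian_complex_finite[of 1]
    by (subst nn_integral_cmult) (auto simp: ennreal_mult_less_top)
  finally show "emeasure gauss_measure (space gauss_measure) \<noteq> \<infinity>" by simp
qed

section \<open>Taylor coefficients and Parseval's identity\<close>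

definition taylor_coeff :: "(complex \<Rightarrow> complex) \<Rightarrow> nat \<Rightarrow> complex" where
  "taylor_coeff f k = (deriv ^^ k) f 0 / fact k"

lemma taylor_sums:
  assumes "f holomorphic_on UNIV"
  shows "(\<lambda>k. taylor_coeff f k * z ^ k) sums f z"
  using holomorphic_power_series[of f 0 "cmod z + 1" z] assms
  by (auto simp: taylor_coeff_def intro: holomorphic_on_subset)

lemma taylor_summable_norm:
  assumes "f holomorphic_on UNIV"
  shows "summable (\<lambda>k. cmod (taylor_coeff f k * z ^ k))"
  using powser_insidea[of "taylor_coeff f" "of_real (cmod z + 1)" z] taylor_sums[OF assms]
  by (auto simp: sums_iff)

lemma measurable_gauss_measure [simp]: "measurable gauss_measure N = measurable borel N"
  by (rule measurable_cong_sets) auto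

lemma gauss_integrable_bounded:
  fixes F :: "complex \<Rightarrow> 'b::{banach,second_countable_topology}"
  assumes "F \<in> borel_measurable borel" "\<And>z. norm (F z) \<le> K"
  shows "integrable gauss_measure F"
  using assms by (intro gauss.integrable_const_bound[of _ K]) auto

lemma borel_measurable_cnj [measurable]: "cnj \<in> borel_measurable borel"
  by (intro borel_measurable_continuous_onI continuous_intros)

lemma indicator_ball_measurable [measurable]:
  fixes R :: real and a :: complex
  shows "(indicator (ball a R) :: complex \<Rightarrow> real) \<in> borel_measurable borel"
    "(indicator (ball a R) :: complex \<Rightarrow> complex) \<in> borel_measurable borel"
    "(indicator (ball a R) :: complex \<Rightarrow> ennreal) \<in> borel_measurable borel"
  by (auto intro!: borel_measurable_indicator)

text \<open>Substituting \<omega> z for z leaves the measure and the disc unchanged and multiplies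
  the integrand by a unimodular factor different from 1, so the integral is 0.\<close>

lemma gauss_monomials_orthogonal:
  assumes "j \<noteq> k"
  shows "(LINT z|gauss_measure. indicator (ball 0 R) z * (z ^ j * cnj (z ^ k))) = 0"
proof -
  have aux: "(LINT z|gauss_measure. indicator (ball 0 R) z * (z ^ j * cnj (z ^ k))) = 0" (is "?I = 0")
    if "j < k" for j k
  proof -
    define d where "d = k - j"
    have d: "d > 0" "k = j + d" using that by (auto simp: d_def)
    define \<omega> where "\<omega> = cis (pi / (2 * d))"
    have \<omega>1: "cmod \<omega> = 1" by (simp add: \<omega>_def)
    have "0 \<le> pi / (2 * d)" "pi / (2 * d) \<le> pi / 2"
      using d by (auto intro!: divide_left_mono simp: divide_le_eq mult_le_cancel_left1)
    then have "Re \<omega> \<ge> 0"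
      unfolding \<omega>_def cis.sel by (intro cos_ge_zero) linarith+
    then have \<omega>2: "Re \<omega> \<noteq> -1" by linarith
    have \<omega>d: "\<omega> ^ d = \<i>"
      using d by (simp add: \<omega>_def Complex.DeMoivre cis_pi_half)
    have \<omega>c: "\<omega> ^ j * cnj (\<omega> ^ j) = 1"
      using \<omega>1 complex_norm_square[of "\<omega> ^ j"] by (simp add: norm_power)
    have "?I = (LINT z|distr gauss_measure borel ((*) \<omega>). indicator (ball 0 R) z * (z ^ j * cnj (z ^ k)))"
      by (simp add: distr_gauss_rotate[OF \<omega>1 \<omega>2])
    also have "\<dots> = (LINT z|gauss_measure. indicator (ball 0 R) (\<omega> * z) * ((\<omega> * z) ^ j * cnj ((\<omega> * z) ^ k)))"
      by (subst integral_distr) (auto intro!: borel_measurable_times borel_measurable_power)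
    also have "\<dots> = (LINT z|gauss_measure. (- \<i>) * (indicator (ball 0 R) z * (z ^ j * cnj (z ^ k))))"
    proof (rule Bochner_Integration.integral_cong[OF refl])
      fix z
      have "(\<omega> * z) ^ j * cnj ((\<omega> * z) ^ k) = (\<omega> ^ j * cnj (\<omega> ^ j)) * cnj (\<omega> ^ d) * (z ^ j * cnj (z ^ k))"
        by (simp add: power_mult_distrib d(2) power_add mult_ac)
      also have "\<dots> = - \<i> * (z ^ j * cnj (z ^ k))"
        unfolding \<omega>c \<omega>d by simp
      finally show "indicator (ball 0 R) (\<omega> * z) * ((\<omega> * z) ^ j * cnj ((\<omega> * z) ^ k))
          = (- \<i>) * (indicator (ball 0 R) z * (z ^ j * cnj (z ^ k)))"
        by (simp add: indicator_def norm_mult \<omega>1)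
    qed
    also have "\<dots> = - \<i> * ?I"
      by (rule integral_mult_right_zero)
    finally have "?I = - \<i> * ?I" .
    moreover have "x = 0" if "x = - \<i> * x" for x
    proof -
      have "(1 + \<i>) * x = 0"
        using that by (simp only: distrib_right mult_1 mult_minus_left eq_neg_iff_add_eq_0)
      then show ?thesis by (simp add: complex_eq_iff[of "1 + \<i>"])
    qed
    ultimately show ?thesis by blast
  qed
  consider "j < k" | "k < j" using assms by linarith
  then show ?thesis
  proof cases
    case 2
    \<comment> \<open>Conjugating the integral exchanges the two exponents.\<close>
    have "(LINT z|gauss_measure. indicator (ball 0 R) z * (z ^ j * cnj (z ^ k)))
        = (LINT z|gauss_measure. cnj (indicator (ball 0 R) z * (z ^ k * cnj (z ^ j))))"
      by (intro Bochner_Integration.integral_cong) (auto simp: indicator_def)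
    also have "\<dots> = cnj 0" by (subst Bochner_Integration.integral_cnj, subst aux[OF 2]) (rule refl)
    finally show ?thesis by simp
  next
    case 1
    then show ?thesis by (rule aux)
  qed
qed

text \<open>Induction on \<open>N\<close>: the new monomial is orthogonal to the previous partial
  sum, so the cross term in the squared modulus integrates to 0. The cutoff makes every integrand
  bounded, hence integrable.\<close>

lemma gauss_ball_pythagoras:
  "(LINT z|gauss_measure. indicator (ball 0 R) z * (cmod (\<Sum>k<N. c k * z ^ k))\<^sup>2)
   = (LINT z|gauss_measure. indicator (ball 0 R) z * (\<Sum>k<N. (cmod (c k * z ^ k))\<^sup>2))"
proof (induction N)
  case 0
  show ?case by simp
next
  case (Suc N)
  define P where "P = (\<lambda>z. \<Sum>k<N. c k * z ^ k)"
  have contP: "continuous_on UNIV P" unfolding P_def by (intro continuous_intros)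
  have int: "integrable gauss_measure (\<lambda>z. indicator (ball 0 R) z *\<^sub>R g z)"
    if "continuous_on UNIV g" for g :: "complex \<Rightarrow> 'b::{banach,second_countable_topology}"
  proof -
    have "bounded (g ` cball 0 R)"
      using that by (intro compact_imp_bounded compact_continuous_image) (auto intro: continuous_on_subset)
    then obtain K where "\<forall>y\<in>g ` cball 0 R. norm y \<le> K" unfolding bounded_iff by blast
    then show ?thesis
      using borel_measurable_continuous_onI[OF that]
      by (intro gauss_integrable_bounded[of _ "max K 0"]) (auto simp: indicator_def le_max_iff_disj)
  qed
  have int1: "integrable gauss_measure (\<lambda>z. indicator (ball 0 R) z * g z)"
    if "continuous_on UNIV g" for g :: "complex \<Rightarrow> real"
    using int[OF that] by simp
  have int2: "integrable gauss_measure (\<lambda>z. indicator (ball 0 R) z * g z)"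
    if "continuous_on UNIV g" for g :: "complex \<Rightarrow> complex"
    using int[OF that] by (rule Bochner_Integration.integrable_cong[THEN iffD1, rotated -1]) (auto simp: indicator_def)
  have cross: "(LINT z|gauss_measure. indicator (ball 0 R) z * Re (P z * cnj (c N * z ^ N))) = 0"
  proof -
    have "(LINT z|gauss_measure. indicator (ball 0 R) z * (P z * cnj (c N * z ^ N)))
        = (LINT z|gauss_measure. (\<Sum>k<N. c k * cnj (c N) * (indicator (ball 0 R) z * (z ^ k * cnj (z ^ N)))))"
      by (intro Bochner_Integration.integral_cong refl)
         (simp add: P_def sum_distrib_left sum_distrib_right mult_ac)
    also have "\<dots> = (\<Sum>k<N. (LINT z|gauss_measure. c k * cnj (c N) * (indicator (ball 0 R) z * (z ^ k * cnj (z ^ N)))))"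
      by (intro Bochner_Integration.integral_sum integrable_mult_right int2 continuous_intros)
    also have "\<dots> = (\<Sum>k<N. c k * cnj (c N) * 0)"
      by (intro sum.cong refl, subst integral_mult_right_zero, subst gauss_monomials_orthogonal) auto
    finally have *: "(LINT z|gauss_measure. indicator (ball 0 R) z * (P z * cnj (c N * z ^ N))) = 0"
      by simp
    have "(LINT z|gauss_measure. indicator (ball 0 R) z * Re (P z * cnj (c N * z ^ N)))
        = (LINT z|gauss_measure. Re (indicator (ball 0 R) z * (P z * cnj (c N * z ^ N))))"
      by (intro Bochner_Integration.integral_cong refl) (auto simp: indicator_def)
    also have "\<dots> = Re (LINT z|gauss_measure. indicator (ball 0 R) z * (P z * cnj (c N * z ^ N)))"
      by (intro integral_Re int2 continuous_intros contP)
    also have "\<dots> = 0" by (simp only: * zero_complex.sel)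
    finally show ?thesis by simp
  qed
  have sq: "(cmod (x + y))\<^sup>2 = (cmod x)\<^sup>2 + 2 * Re (x * cnj y) + (cmod y)\<^sup>2" for x y
    unfolding cmod_power2 by (simp add: power2_eq_square algebra_simps)
  have i1: "integrable gauss_measure (\<lambda>z. indicator (ball 0 R) z * (cmod (P z))\<^sup>2)"
    by (intro int1 continuous_intros contP)
  have i2: "integrable gauss_measure (\<lambda>z. indicator (ball 0 R) z * Re (P z * cnj (c N * z ^ N)))"
    by (intro int1 continuous_intros contP)
  have i3: "integrable gauss_measure (\<lambda>z. indicator (ball 0 R) z * (cmod (c N * z ^ N))\<^sup>2)"
    by (intro int1 continuous_intros)
  have "(LINT z|gauss_measure. indicator (ball 0 R) z * (cmod (P z + c N * z ^ N))\<^sup>2)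
      = (LINT z|gauss_measure. indicator (ball 0 R) z * (cmod (P z))\<^sup>2
          + 2 * (indicator (ball 0 R) z * Re (P z * cnj (c N * z ^ N)))
          + indicator (ball 0 R) z * (cmod (c N * z ^ N))\<^sup>2)"
    unfolding sq by (intro Bochner_Integration.integral_cong refl) (simp add: algebra_simps)
  also have "\<dots> = (LINT z|gauss_measure. indicator (ball 0 R) z * (cmod (P z))\<^sup>2)
      + 2 * (LINT z|gauss_measure. indicator (ball 0 R) z * Re (P z * cnj (c N * z ^ N)))
      + (LINT z|gauss_measure. indicator (ball 0 R) z * (cmod (c N * z ^ N))\<^sup>2)"
    by (simp only: Bochner_Integration.integral_add Bochner_Integration.integrable_add
          integrable_mult_right i1 i2 i3 integral_mult_right_zero)
  also have "\<dots> = (LINT z|gauss_measure. indicator (ball 0 R) z * (cmod (P z))\<^sup>2)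
      + (LINT z|gauss_measure. indicator (ball 0 R) z * (cmod (c N * z ^ N))\<^sup>2)"
    by (simp only: cross mult_zero_right add_0_right)
  also have "(LINT z|gauss_measure. indicator (ball 0 R) z * (cmod (P z))\<^sup>2)
      = (LINT z|gauss_measure. indicator (ball 0 R) z * (\<Sum>k<N. (cmod (c k * z ^ k))\<^sup>2))"
    unfolding P_def by (rule Suc.IH)
  also have "\<dots> + (LINT z|gauss_measure. indicator (ball 0 R) z * (cmod (c N * z ^ N))\<^sup>2)
      = (LINT z|gauss_measure. indicator (ball 0 R) z * (\<Sum>k<N. (cmod (c k * z ^ k))\<^sup>2)
           + indicator (ball 0 R) z * (cmod (c N * z ^ N))\<^sup>2)"
    by (rule Bochner_Integration.integral_add[symmetric]) (intro int1 continuous_intros)+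
  finally show ?case
    unfolding P_def by (simp only: sum.lessThan_Suc distrib_left)
qed

text \<open>On each disc the finite Pythagoras identity passes to the limit by dominated
  convergence; monotone convergence in the radius then removes the cutoff. Both sides may be
  infinite.\<close>

lemma nn_integral_gauss_norm2:
  assumes f: "f holomorphic_on UNIV"
  shows "(\<integral>\<^sup>+z. ennreal ((cmod (f z))\<^sup>2) \<partial>gauss_measure)
    = (\<Sum>k. \<integral>\<^sup>+z. ennreal ((cmod (taylor_coeff f k * z ^ k))\<^sup>2) \<partial>gauss_measure)"
proof -
  define c where "c = taylor_coeff f"
  define S where "S = (\<lambda>z. \<Sum>k. ennreal ((cmod (c k * z ^ k))\<^sup>2))"
  have [measurable]: "f \<in> borel_measurable borel"
    using f by (rule holomorphic_imp_borel_measurable)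
  have [measurable]: "S \<in> borel_measurable borel" unfolding S_def by measurable
  have ball: "(\<integral>\<^sup>+z. indicator (ball 0 R) z * ennreal ((cmod (f z))\<^sup>2) \<partial>gauss_measure)
      = (\<integral>\<^sup>+z. indicator (ball 0 R) z * S z \<partial>gauss_measure)" if "R > 0" for R :: real
  proof -
    define s where "s = (\<lambda>z. \<Sum>k. (cmod (c k * z ^ k))\<^sup>2)"
    \<comment> \<open>\<open>K\<close> bounds all partial sums of the moduli on the disc, and its
      square bounds the sums of squares as well. A constant is an admissible dominating function
      because the measure is finite.\<close>
    define K where "K = (\<Sum>k. cmod (c k * of_real R ^ k))"
    have sumR: "summable (\<lambda>k. cmod (c k * of_real R ^ k))"
      unfolding c_def by (rule taylor_summable_norm[OF f])
    have K0: "K \<ge> 0" unfolding K_def by (intro suminf_nonneg sumR) auto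
    have le: "cmod (c k * z ^ k) \<le> cmod (c k * of_real R ^ k)" if "z \<in> ball 0 R" for z k
      using that by (auto simp: norm_mult norm_power intro!: mult_left_mono power_mono)
    have partial: "(\<Sum>k<N. cmod (c k * z ^ k)) \<le> K" if "z \<in> ball 0 R" for z N
      unfolding K_def using le[OF that]
      by (intro order.trans[OF sum_mono sum_le_suminf[OF sumR]]) auto
    have sumsq: "(\<Sum>k<N. (cmod (c k * z ^ k))\<^sup>2) \<le> K\<^sup>2" if "z \<in> ball 0 R" for z N
    proof -
      have "(\<Sum>k<N. (cmod (c k * z ^ k))\<^sup>2) \<le> (\<Sum>k<N. cmod (c k * z ^ k))\<^sup>2"
        by (intro sqrt_le_D) (use L2_set_le_sum[of "{..<N}" "\<lambda>k. cmod (c k * z ^ k)"] in \<open>simp add: L2_set_def\<close>)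
      also have "\<dots> \<le> K\<^sup>2" by (intro power_mono partial that sum_nonneg) auto
      finally show ?thesis .
    qed
    have summ: "summable (\<lambda>k. (cmod (c k * z ^ k))\<^sup>2)" for z
    proof (rule summable_comparison_test_ev)
      have s1: "summable (\<lambda>k. cmod (c k * z ^ k))"
        unfolding c_def by (rule taylor_summable_norm[OF f])
      have "\<forall>\<^sub>F k in sequentially. cmod (c k * z ^ k) < 1"
        using order_tendstoD(2)[OF summable_LIMSEQ_zero[OF s1], of 1] by simp
      then show "\<forall>\<^sub>F k in sequentially. norm ((cmod (c k * z ^ k))\<^sup>2) \<le> cmod (c k * z ^ k)"
        by eventually_elim (auto simp: power2_eq_square intro!: mult_left_le_one_le)
      show "summable (\<lambda>k. cmod (c k * z ^ k))" by (rule s1)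
    qed
    have Ss: "S z = ennreal (s z)" for z
      unfolding S_def s_def using summ by (intro suminf_ennreal2) auto
    have [measurable]: "s \<in> borel_measurable borel" unfolding s_def by measurable
    have lim1: "(\<lambda>N. LINT z|gauss_measure. indicator (ball 0 R) z * (cmod (\<Sum>k<N. c k * z ^ k))\<^sup>2)
        \<longlonglongrightarrow> (LINT z|gauss_measure. indicator (ball 0 R) z * (cmod (f z))\<^sup>2)"
    proof (rule integral_dominated_convergence[where w = "\<lambda>_. K\<^sup>2"])
      show "AE z in gauss_measure. (\<lambda>N. indicator (ball 0 R) z * (cmod (\<Sum>k<N. c k * z ^ k))\<^sup>2)
          \<longlonglongrightarrow> indicator (ball 0 R) z * (cmod (f z))\<^sup>2"
        using taylor_sums[OF f] unfolding c_def sums_def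
        by (intro AE_I2 tendsto_intros)
      show "AE z in gauss_measure. norm (indicator (ball 0 R) z * (cmod (\<Sum>k<N. c k * z ^ k))\<^sup>2) \<le> K\<^sup>2" for N
      proof (rule AE_I2)
        fix z
        have "cmod (\<Sum>k<N. c k * z ^ k) \<le> K" if "z \<in> ball 0 R"
          using norm_sum partial[OF that] by (rule order.trans)
        then show "norm (indicator (ball 0 R) z * (cmod (\<Sum>k<N. c k * z ^ k))\<^sup>2) \<le> K\<^sup>2"
          by (auto simp: indicator_def power_mono)
      qed
    qed auto
    have lim2: "(\<lambda>N. LINT z|gauss_measure. indicator (ball 0 R) z * (\<Sum>k<N. (cmod (c k * z ^ k))\<^sup>2))
        \<longlonglongrightarrow> (LINT z|gauss_measure. indicator (ball 0 R) z * s z)"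
    proof (rule integral_dominated_convergence[where w = "\<lambda>_. K\<^sup>2"])
      show "AE z in gauss_measure. (\<lambda>N. indicator (ball 0 R) z * (\<Sum>k<N. (cmod (c k * z ^ k))\<^sup>2))
          \<longlonglongrightarrow> indicator (ball 0 R) z * s z"
        using summable_LIMSEQ[OF summ] unfolding s_def by (intro AE_I2 tendsto_intros)
      show "AE z in gauss_measure. norm (indicator (ball 0 R) z * (\<Sum>k<N. (cmod (c k * z ^ k))\<^sup>2)) \<le> K\<^sup>2" for N
        using sumsq by (intro AE_I2) (auto simp: indicator_def sum_nonneg)
    qed auto
    \<comment> \<open>By \<open>gauss_ball_pythagoras\<close> the sequences in \<open>lim1\<close>
      and \<open>lim2\<close> are the same.\<close>
    have eq: "(LINT z|gauss_measure. indicator (ball 0 R) z * (cmod (f z))\<^sup>2)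
        = (LINT z|gauss_measure. indicator (ball 0 R) z * s z)"
      using LIMSEQ_unique[OF lim1[unfolded gauss_ball_pythagoras] lim2] .
    have fK: "cmod (f z) \<le> K" if "z \<in> ball 0 R" for z
    proof (rule Lim_bounded)
      show "(\<lambda>N. cmod (\<Sum>k<N. c k * z ^ k)) \<longlonglongrightarrow> cmod (f z)"
        using taylor_sums[OF f] unfolding c_def sums_def by (intro tendsto_intros)
      show "\<forall>N\<ge>0. cmod (\<Sum>k<N. c k * z ^ k) \<le> K"
        using norm_sum partial[OF that] by (auto intro: order.trans)
    qed
    have s0: "s z \<ge> 0" for z unfolding s_def by (intro suminf_nonneg summ) auto
    have sK: "s z \<le> K\<^sup>2" if "z \<in> ball 0 R" for z
      unfolding s_def using sumsq[OF that] by (intro suminf_le_const summ) auto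
    have "(\<integral>\<^sup>+z. indicator (ball 0 R) z * ennreal ((cmod (f z))\<^sup>2) \<partial>gauss_measure)
        = (\<integral>\<^sup>+z. ennreal (indicator (ball 0 R) z * (cmod (f z))\<^sup>2) \<partial>gauss_measure)"
      by (intro nn_integral_cong) (auto simp: indicator_def)
    also have "\<dots> = ennreal (LINT z|gauss_measure. indicator (ball 0 R) z * (cmod (f z))\<^sup>2)"
      using fK by (intro nn_integral_eq_integral gauss_integrable_bounded[of _ "K\<^sup>2"])
        (auto simp: indicator_def power_mono)
    also have "\<dots> = (\<integral>\<^sup>+z. ennreal (indicator (ball 0 R) z * s z) \<partial>gauss_measure)"
      unfolding eq using s0 sK
      by (intro nn_integral_eq_integral[symmetric] gauss_integrable_bounded[of _ "K\<^sup>2"])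
        (auto simp: indicator_def)
    also have "\<dots> = (\<integral>\<^sup>+z. indicator (ball 0 R) z * S z \<partial>gauss_measure)"
      by (intro nn_integral_cong) (auto simp: indicator_def Ss)
    finally show ?thesis .
  qed
  \<comment> \<open>The radii start at \<open>Suc 0\<close> because \<open>ball\<close> is available
    only for positive radius.\<close>
  have lim: "(\<integral>\<^sup>+z. G z \<partial>gauss_measure)
      = (SUP n. \<integral>\<^sup>+z. indicator (ball 0 (real (Suc n))) z * G z \<partial>gauss_measure)"
    if [measurable]: "G \<in> borel_measurable borel" for G :: "complex \<Rightarrow> ennreal"
  proof (subst nn_integral_monotone_convergence_SUP[symmetric])
    show "incseq (\<lambda>n z. indicator (ball 0 (real (Suc n))) z * G z)"
      by (auto simp: incseq_def le_fun_def indicator_def)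
    have "(SUP n. indicator (ball 0 (real (Suc n))) z * G z) = G z" for z
    proof (rule antisym)
      show "(SUP n. indicator (ball 0 (real (Suc n))) z * G z) \<le> G z"
        by (intro SUP_least) (auto simp: indicator_def)
      obtain n where "cmod z < real n" using reals_Archimedean2 by blast
      then have "G z = indicator (ball 0 (real (Suc n))) z * G z" by (simp add: indicator_def)
      then show "G z \<le> (SUP n. indicator (ball 0 (real (Suc n))) z * G z)"
        using SUP_upper[of n UNIV "\<lambda>n. indicator (ball 0 (real (Suc n))) z * G z"] by simp
    qed
    then show "(\<integral>\<^sup>+z. G z \<partial>gauss_measure)
        = (\<integral>\<^sup>+z. (SUP n. indicator (ball 0 (real (Suc n))) z * G z) \<partial>gauss_measure)" by simp
  qed auto
  have "(\<integral>\<^sup>+z. ennreal ((cmod (f z))\<^sup>2) \<partial>gauss_measure) = (\<integral>\<^sup>+z. S z \<partial>gauss_measure)"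
    by (subst lim, measurable, subst (2) lim, measurable) (simp add: ball del: of_nat_Suc)
  also have "\<dots> = (\<Sum>k. \<integral>\<^sup>+z. ennreal ((cmod (c k * z ^ k))\<^sup>2) \<partial>gauss_measure)"
    unfolding S_def by (rule nn_integral_suminf) auto
  finally show ?thesis unfolding c_def .
qed

section \<open>Membership in the Fock space, growth criteria and the real Parseval identity\<close>

lemma fock_iff_nn_integral:
  assumes "f holomorphic_on UNIV"
  shows "f \<in> fock \<longleftrightarrow> (\<integral>\<^sup>+z. ennreal ((cmod (f z))\<^sup>2) \<partial>gauss_measure) < \<infinity>"
  using assms holomorphic_imp_borel_measurable[OF assms]
  by (auto simp: fock_def integrable_iff_bounded)

lemma fock_norm_nn_integral:
  assumes "f \<in> fock"
  shows "ennreal ((fock_norm f)\<^sup>2) = (\<integral>\<^sup>+z. ennreal ((cmod (f z))\<^sup>2) \<partial>gauss_measure)"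
  using assms unfolding fock_norm_power2 fock_def by (intro nn_integral_eq_integral[symmetric]) auto

lemma fock_holomorphic: "f \<in> fock \<Longrightarrow> f holomorphic_on UNIV"
  by (simp add: fock_def)

lemma holomorphic_compose_UNIV:
  fixes f g :: "complex \<Rightarrow> complex"
  assumes "f holomorphic_on UNIV" "g holomorphic_on UNIV"
  shows "(\<lambda>z. f (g z)) holomorphic_on UNIV"
  using holomorphic_on_compose_gen[OF assms(2,1)] by (simp add: o_def)

lemma gauss_growth_integral_finite:
  assumes "q < 1"
  shows "(\<integral>\<^sup>+z. ennreal (exp (q * (cmod z)\<^sup>2)) \<partial>gauss_measure) < \<infinity>"
proof -
  have "(\<integral>\<^sup>+z. ennreal (exp (q * (cmod z)\<^sup>2)) \<partial>gauss_measure)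
      = (\<integral>\<^sup>+z. ennreal (1 / pi) * ennreal (exp (- (1 - q) * (cmod z)\<^sup>2)) \<partial>lborel)"
    by (subst nn_integral_gauss)
       (auto simp: ennreal_mult'[symmetric] exp_add[symmetric] algebra_simps intro!: nn_integral_cong)
  also have "\<dots> < \<infinity>"
    using nn_integral_gaussian_complex_finite[of "1 - q"] assms
    by (subst nn_integral_cmult) (auto simp: ennreal_mult_less_top)
  finally show ?thesis .
qed

text \<open>The constant \<open>J\<close> is fixed before \<open>f\<close> and \<open>B\<close>, so
  a pointwise growth estimate turns into a norm bound uniform in \<open>f\<close>. For q < 1 the
  weight exp(-(1-q)|z|^2) remains and is integrable.\<close>

lemma fock_growth:
  assumes "q < 1"
  obtains J where "J \<ge> 0"
    "\<And>f B. f holomorphic_on UNIV \<Longrightarrow> B \<ge> 0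
      \<Longrightarrow> (\<And>z. (cmod (f z))\<^sup>2 \<le> B * exp (q * (cmod z)\<^sup>2))
      \<Longrightarrow> f \<in> fock \<and> (fock_norm f)\<^sup>2 \<le> B * J"
proof -
  define I where "I = (\<integral>\<^sup>+z. ennreal (exp (q * (cmod z)\<^sup>2)) \<partial>gauss_measure)"
  have I: "I < \<infinity>" unfolding I_def by (rule gauss_growth_integral_finite[OF assms])
  have "f \<in> fock \<and> (fock_norm f)\<^sup>2 \<le> B * enn2real I"
    if f: "f holomorphic_on UNIV" and B: "B \<ge> 0"
      and le: "\<And>z. (cmod (f z))\<^sup>2 \<le> B * exp (q * (cmod z)\<^sup>2)" for f B
  proof -
    have "(\<integral>\<^sup>+z. ennreal ((cmod (f z))\<^sup>2) \<partial>gauss_measure)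
        \<le> (\<integral>\<^sup>+z. ennreal B * ennreal (exp (q * (cmod z)\<^sup>2)) \<partial>gauss_measure)"
      using le B by (intro nn_integral_mono) (simp add: ennreal_mult'[symmetric])
    also have "\<dots> = ennreal B * I"
      unfolding I_def by (rule nn_integral_cmult) simp
    also have "\<dots> = ennreal (B * enn2real I)"
      using I B by (cases I) (auto simp: ennreal_mult')
    finally have *: "(\<integral>\<^sup>+z. ennreal ((cmod (f z))\<^sup>2) \<partial>gauss_measure) \<le> ennreal (B * enn2real I)" .
    then have "f \<in> fock"
      unfolding fock_iff_nn_integral[OF f] by (rule le_less_trans) simp
    with * B show ?thesis
      by (simp add: fock_norm_nn_integral[symmetric] ennreal_le_iff)
  qed
  then show ?thesis by (intro that[of "enn2real I"]) auto
qed

lemma fock_power: "(\<lambda>z. z ^ k) \<in> fock"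
proof -
  obtain J where J: "\<And>f B. f holomorphic_on UNIV \<Longrightarrow> B \<ge> 0
      \<Longrightarrow> (\<And>z. (cmod (f z))\<^sup>2 \<le> B * exp (1/2 * (cmod z)\<^sup>2))
      \<Longrightarrow> f \<in> fock \<and> (fock_norm f)\<^sup>2 \<le> B * J"
    by (rule fock_growth[of "1/2"]) auto
  \<comment> \<open>With x = |z|^2/2, a single term of the exponential series gives x^k \<le> k! exp
    x, and |z^k|^2 = (2x)^k supplies the factor 2^k.\<close>
  have "(cmod (z ^ k))\<^sup>2 \<le> (2 ^ k * fact k) * exp (1/2 * (cmod z)\<^sup>2)" for z
  proof -
    define x where "x = 1/2 * (cmod z)\<^sup>2"
    have x: "x \<ge> 0" by (simp add: x_def)
    have "(\<Sum>n\<in>{k}. x ^ n /\<^sub>R fact n) \<le> exp x"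
      unfolding exp_def by (rule sum_le_suminf[OF summable_exp_generic]) (use x in auto)
    then have le: "x ^ k \<le> fact k * exp x" by (simp add: field_simps)
    have "(cmod (z ^ k))\<^sup>2 = (2 * x) ^ k"
      by (simp add: x_def norm_power mult.commute flip: power_mult)
    also have "\<dots> = 2 ^ k * x ^ k" by (rule power_mult_distrib)
    also have "\<dots> \<le> 2 ^ k * (fact k * exp x)" by (rule mult_left_mono[OF le]) simp
    finally show ?thesis by (simp add: x_def)
  qed
  then show ?thesis
    by (intro J[THEN conjunct1, of _ "2 ^ k * fact k"] holomorphic_intros) auto
qed

lemma fock_norm_power_pos: "fock_norm (\<lambda>z. z ^ k) > 0"
proof -
  have "(\<lambda>z::complex. z ^ k) \<noteq> 0"
    by (auto simp: fun_eq_iff intro!: exI[of _ 1])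
  then show ?thesis
    using fock_norm_zero_imp[OF fock_power[of k]] fock_norm_nonneg[of "\<lambda>z. z ^ k"] by force
qed

lemma fock_parseval:
  assumes "f \<in> fock"
  shows "(\<lambda>k. (cmod (taylor_coeff f k))\<^sup>2 * (fock_norm (\<lambda>z. z ^ k))\<^sup>2) sums (fock_norm f)\<^sup>2"
proof -
  define a where "a = (\<lambda>k. (cmod (taylor_coeff f k))\<^sup>2 * (fock_norm (\<lambda>z. z ^ k))\<^sup>2)"
  have "(\<integral>\<^sup>+z. ennreal ((cmod (taylor_coeff f k * z ^ k))\<^sup>2) \<partial>gauss_measure) = ennreal (a k)" for k
  proof -
    have "(\<integral>\<^sup>+z. ennreal ((cmod (taylor_coeff f k * z ^ k))\<^sup>2) \<partial>gauss_measure)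
        = (\<integral>\<^sup>+z. ennreal ((cmod (taylor_coeff f k))\<^sup>2) * ennreal ((cmod (z ^ k))\<^sup>2) \<partial>gauss_measure)"
      by (simp add: norm_mult power_mult_distrib ennreal_mult')
    also have "\<dots> = ennreal (a k)"
      by (subst nn_integral_cmult) (auto simp: a_def fock_norm_nn_integral[OF fock_power, symmetric] ennreal_mult')
    finally show ?thesis .
  qed
  then have "(\<Sum>k. ennreal (a k)) = ennreal ((fock_norm f)\<^sup>2)"
    using nn_integral_gauss_norm2[OF fock_holomorphic[OF assms]] assms
    by (simp add: fock_norm_nn_integral)
  then have "(\<lambda>k. ennreal (a k)) sums ennreal ((fock_norm f)\<^sup>2)"
    by (simp add: sums_iff)
  then show ?thesis
    unfolding a_def by (subst (asm) sums_ennreal) auto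
qed

text \<open>A single term of the Parseval series is at most the whole sum; this makes each Taylor
  coefficient a bounded functional.\<close>

lemma taylor_coeff_le:
  assumes "f \<in> fock"
  shows "cmod (taylor_coeff f k) * fock_norm (\<lambda>z. z ^ k) \<le> fock_norm f"
proof (rule power2_le_imp_le[OF _ fock_norm_nonneg])
  have "(\<Sum>k\<in>{k}. (cmod (taylor_coeff f k))\<^sup>2 * (fock_norm (\<lambda>z. z ^ k))\<^sup>2) \<le> (fock_norm f)\<^sup>2"
    using fock_parseval[OF assms] by (intro sum_le_suminf[THEN order.trans]) (auto simp: sums_iff)
  then show "(cmod (taylor_coeff f k) * fock_norm (\<lambda>z. z ^ k))\<^sup>2 \<le> (fock_norm f)\<^sup>2"
    by (simp add: power_mult_distrib)
qed

section \<open>Weyl translations, kernels and point evaluations\<close>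

text \<open>The exponential factor completes the square: -|x|^2 - 2 Re(x cnj z) = |z|^2 - |z+x|^2.
  What remains is a translation of Lebesgue measure.\<close>

lemma nn_integral_gauss_translate:
  assumes "f holomorphic_on UNIV"
  shows "(\<integral>\<^sup>+x. ennreal ((cmod (f (z + x) * exp (- x * cnj z)))\<^sup>2) \<partial>gauss_measure)
    = ennreal (exp ((cmod z)\<^sup>2)) * (\<integral>\<^sup>+x. ennreal ((cmod (f x))\<^sup>2) \<partial>gauss_measure)"
proof -
  have [measurable]: "f \<in> borel_measurable borel"
    using assms by (rule holomorphic_imp_borel_measurable)
  have "(\<lambda>x. f (z + x) * exp (- x * cnj z)) holomorphic_on UNIV"
    by (intro holomorphic_intros holomorphic_compose_UNIV[OF assms])
  note [measurable] = holomorphic_imp_borel_measurable[OF this]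
  define G where "G = (\<lambda>u. ennreal (exp ((cmod z)\<^sup>2)) * (ennreal (exp (- (cmod u)\<^sup>2) / pi) * ennreal ((cmod (f u))\<^sup>2)))"
  have [measurable]: "G \<in> borel_measurable borel" unfolding G_def by measurable
  have *: "- (cmod x)\<^sup>2 - 2 * Re (x * cnj z) = (cmod z)\<^sup>2 - (cmod (z + x))\<^sup>2" for x
    unfolding cmod_power2 by (simp add: power2_eq_square algebra_simps)
  have "exp (- (cmod x)\<^sup>2) / pi * (cmod (f (z + x) * exp (- x * cnj z)))\<^sup>2
      = exp ((cmod z)\<^sup>2) * (exp (- (cmod (z + x))\<^sup>2) / pi * (cmod (f (z + x)))\<^sup>2)" for x
  proof -
    have "exp (- (cmod x)\<^sup>2) * (exp (- Re (x * cnj z)))\<^sup>2 = exp (- (cmod x)\<^sup>2 - 2 * Re (x * cnj z))"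
      by (simp only: exp_double[symmetric] exp_add[symmetric]) (rule arg_cong[of _ _ exp], linarith)
    also have "\<dots> = exp ((cmod z)\<^sup>2) * exp (- (cmod (z + x))\<^sup>2)"
      unfolding * by (simp add: exp_diff exp_minus divide_inverse)
    finally have "exp (- (cmod x)\<^sup>2) * (exp (- Re (x * cnj z)))\<^sup>2 = exp ((cmod z)\<^sup>2) * exp (- (cmod (z + x))\<^sup>2)" .
    then show ?thesis
      by (simp add: norm_mult power_mult_distrib)
  qed
  then have "ennreal (exp (- (cmod x)\<^sup>2) / pi) * ennreal ((cmod (f (z + x) * exp (- x * cnj z)))\<^sup>2) = G (z + x)" for x
    unfolding G_def by (simp add: ennreal_mult'[symmetric])
  then have "(\<integral>\<^sup>+x. ennreal ((cmod (f (z + x) * exp (- x * cnj z)))\<^sup>2) \<partial>gauss_measure) = (\<integral>\<^sup>+x. G (z + x) \<partial>lborel)"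
    by (subst nn_integral_gauss) auto
  also have "\<dots> = (\<integral>\<^sup>+x. G x \<partial>lborel)" by (rule nn_integral_lborel_shift_complex) measurable
  also have "\<dots> = ennreal (exp ((cmod z)\<^sup>2)) * (\<integral>\<^sup>+x. ennreal ((cmod (f x))\<^sup>2) \<partial>gauss_measure)"
    unfolding G_def by (subst nn_integral_gauss, measurable, rule nn_integral_cmult, measurable)
  finally show ?thesis .
qed

lemma fock_translate:
  assumes "f \<in> fock"
  shows "(\<lambda>x. f (z + x) * exp (- x * cnj z)) \<in> fock" (is "?g \<in> _")
    and "fock_norm (\<lambda>x. f (z + x) * exp (- x * cnj z)) = exp ((cmod z)\<^sup>2 / 2) * fock_norm f"
proof -
  have hol: "?g holomorphic_on UNIV"
    by (intro holomorphic_intros holomorphic_compose_UNIV[OF fock_holomorphic[OF assms]])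
  note eq = nn_integral_gauss_translate[OF fock_holomorphic[OF assms], of z,
      folded fock_norm_nn_integral[OF assms]]
  show g: "?g \<in> fock"
    unfolding fock_iff_nn_integral[OF hol] eq by (simp add: ennreal_mult_less_top)
  have "(fock_norm ?g)\<^sup>2 = exp ((cmod z)\<^sup>2) * (fock_norm f)\<^sup>2"
    using eq unfolding fock_norm_nn_integral[OF g, symmetric] by (simp add: ennreal_mult'[symmetric])
  also have "\<dots> = (exp ((cmod z)\<^sup>2 / 2) * fock_norm f)\<^sup>2"
    by (simp add: power_mult_distrib flip: exp_double)
  finally show "fock_norm ?g = exp ((cmod z)\<^sup>2 / 2) * fock_norm f"
    by (simp add: fock_norm_nonneg)
qed

lemma fock_const: "(\<lambda>_. c) \<in> fock"
  using fock_scale_closed[OF fock_power[of 0], of c] by (simp add: cscale_def)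

lemma fock_norm_one_pos: "fock_norm (\<lambda>_. 1) > 0"
  using fock_norm_power_pos[of 0] by simp

text \<open>The kernel at \<open>w\<close> is the translate of the constant 1 by
  \<open>- w\<close>.\<close>

lemma fock_kernel_in_fock: "fock_kernel w \<in> fock"
  and fock_norm_kernel: "fock_norm (fock_kernel w) = exp ((cmod w)\<^sup>2 / 2) * fock_norm (\<lambda>_. 1)"
  using fock_translate[OF fock_const[of 1], of "- w"] by (simp_all add: fock_kernel_def[abs_def])

text \<open>The value f(z) is the constant Taylor coefficient of the translate of \<open>f\<close>
  by \<open>z\<close>, so the coefficient bound for k = 0 applies.\<close>

lemma fock_eval_le:
  assumes "f \<in> fock"
  shows "cmod (f z) * fock_norm (\<lambda>_. 1) \<le> exp ((cmod z)\<^sup>2 / 2) * fock_norm f"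
  using taylor_coeff_le[OF fock_translate(1)[OF assms], of z 0] fock_translate(2)[OF assms, of z]
  by (simp add: taylor_coeff_def)

section \<open>Taylor coefficients and evaluations under norm convergence\<close>

lemma fock_diff_closed: "f \<in> fock \<Longrightarrow> g \<in> fock \<Longrightarrow> f - g \<in> fock"
  using cfun.subspace_diff[OF fock_subspace] .

lemma taylor_coeff_add:
  "f holomorphic_on UNIV \<Longrightarrow> g holomorphic_on UNIV \<Longrightarrow>
    taylor_coeff (f + g) k = taylor_coeff f k + taylor_coeff g k"
  unfolding taylor_coeff_def plus_fun_def
  by (subst higher_deriv_add[of f UNIV g]) (auto simp: add_divide_distrib)

lemma taylor_coeff_diff:
  "f holomorphic_on UNIV \<Longrightarrow> g holomorphic_on UNIV \<Longrightarrow>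
    taylor_coeff (f - g) k = taylor_coeff f k - taylor_coeff g k"
  unfolding taylor_coeff_def fun_diff_def
  by (subst higher_deriv_diff[of f UNIV g]) (auto simp: diff_divide_distrib)

lemma taylor_coeff_scale:
  "f holomorphic_on UNIV \<Longrightarrow> taylor_coeff (cscale c f) k = c * taylor_coeff f k"
  unfolding taylor_coeff_def cscale_def
  by (subst higher_deriv_cmult[of f UNIV]) auto

lemma taylor_coeff_dilate:
  "f holomorphic_on UNIV \<Longrightarrow> taylor_coeff (\<lambda>z. f (a * z)) k = a ^ k * taylor_coeff f k"
  unfolding taylor_coeff_def
  by (subst higher_deriv_compose_linear[of f UNIV UNIV]) auto

lemma taylor_coeff_power: "taylor_coeff (\<lambda>z. z ^ j) k = (if k = j then 1 else 0)"
proof -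
  have "(deriv ^^ k) (\<lambda>w::complex. (w - 0) ^ j) 0 = pochhammer (of_nat (Suc j - k)) k * 0 ^ (j - k)"
    using higher_deriv_power[of k 0 j 0] by (simp only: diff_zero)
  \<comment> \<open>For k > j the natural subtraction truncates to 0, and the rising product starts
    with that 0. For k < j the power of 0 vanishes instead.\<close>
  moreover have "pochhammer (of_nat (Suc j - k) :: complex) k = 0" if "k > j"
    using that by (cases k) (auto simp: pochhammer_0_left)
  moreover have "pochhammer (1::complex) k = fact k"
    by (simp add: pochhammer_fact)
  ultimately show ?thesis
    by (auto simp: taylor_coeff_def power_0_left)
qed

lemma taylor_coeff_const: "taylor_coeff (\<lambda>z. c) k = (if k = 0 then c else 0)"
  by (simp add: taylor_coeff_def)

lemma taylor_coeff_exp: "taylor_coeff (\<lambda>z. exp (c * z)) k = c ^ k / fact k"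
proof -
  have "deriv exp = (exp :: complex \<Rightarrow> complex)"
    by (rule ext) (rule DERIV_imp_deriv[OF DERIV_exp])
  then have "(deriv ^^ k) exp = (exp :: complex \<Rightarrow> complex)" for k
    by (induction k) simp_all
  then show ?thesis
    using taylor_coeff_dilate[of exp c k] by (simp add: taylor_coeff_def holomorphic_on_exp)
qed

text \<open>Dominated convergence for the Parseval series: coefficientwise convergence becomes norm
  convergence once one fixed Fock function dominates all coefficients.\<close>

lemma fock_tendsto_dominated:
  assumes g: "\<And>n. g n \<in> fock" and f: "f \<in> fock" and F: "F \<in> fock"
    and dom: "\<And>n k. cmod (taylor_coeff (g n) k) \<le> B * cmod (taylor_coeff F k)"
    and lim: "\<And>k. (\<lambda>n. taylor_coeff (g n) k) \<longlonglongrightarrow> taylor_coeff f k"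
  shows "(\<lambda>n. fock_norm (f - g n)) \<longlonglongrightarrow> 0"
proof -
  define w where "w = (\<lambda>k. (fock_norm (\<lambda>z. z ^ k))\<^sup>2)"
  \<comment> \<open>One \<open>B\<close> bounds the coefficients of \<open>g n\<close>, and the
    other those of the limit \<open>f\<close>, which inherit the bound.\<close>
  define M where "M = (\<lambda>k. (2 * B)\<^sup>2 * ((cmod (taylor_coeff F k))\<^sup>2 * w k))"
  define a where "a = (\<lambda>k n. (cmod (taylor_coeff (f - g n) k))\<^sup>2 * w k)"
  have coeff: "taylor_coeff (f - g n) k = taylor_coeff f k - taylor_coeff (g n) k" for n k
    by (intro taylor_coeff_diff fock_holomorphic f g)
  have "summable M"
    unfolding M_def using fock_parseval[OF F] unfolding w_def
    by (intro summable_mult) (auto simp: sums_iff)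
  moreover have "(\<lambda>n. a k n) \<longlonglongrightarrow> 0" for k
  proof -
    have "(\<lambda>n. a k n) \<longlonglongrightarrow> (cmod (taylor_coeff f k - taylor_coeff f k))\<^sup>2 * w k"
      unfolding a_def coeff by (intro tendsto_intros lim)
    then show ?thesis by simp
  qed
  moreover have "norm (a k n) \<le> M k" for k n
  proof -
    have "cmod (taylor_coeff f k) \<le> B * cmod (taylor_coeff F k)"
      using lim[of k] dom[of _ k] by (intro Lim_bounded[OF tendsto_norm]) auto
    then have "cmod (taylor_coeff f k - taylor_coeff (g n) k) \<le> 2 * B * cmod (taylor_coeff F k)"
      using norm_triangle_ineq4[of "taylor_coeff f k" "taylor_coeff (g n) k"] dom[of n k] by linarith
    then have "(cmod (taylor_coeff f k - taylor_coeff (g n) k))\<^sup>2 \<le> (2 * B * cmod (taylor_coeff F k))\<^sup>2"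
      by (intro power_mono) auto
    then have "(cmod (taylor_coeff f k - taylor_coeff (g n) k))\<^sup>2 * w k \<le> (2 * B * cmod (taylor_coeff F k))\<^sup>2 * w k"
      by (intro mult_right_mono) (auto simp: w_def)
    then show ?thesis
      by (simp add: a_def M_def coeff w_def power_mult_distrib mult_ac)
  qed
  ultimately have "(\<lambda>n. \<Sum>k. a k n) \<longlonglongrightarrow> (\<Sum>k. 0)"
    using tannerys_theorem[where a = a and b = "\<lambda>_. 0" and F = sequentially and M = M]
    by (auto simp del: real_norm_def intro: always_eventually)
  moreover have "(\<Sum>k. a k n) = (fock_norm (f - g n))\<^sup>2" for n
    using fock_parseval[OF fock_diff_closed[OF f g]] by (simp add: a_def w_def sums_iff)
  ultimately have "(\<lambda>n. sqrt ((fock_norm (f - g n))\<^sup>2)) \<longlonglongrightarrow> sqrt 0"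
    by (intro tendsto_real_sqrt) simp
  then show ?thesis by (simp add: fock_norm_nonneg)
qed

lemma fock_eval_tendsto:
  assumes "\<And>n. g n \<in> fock" "f \<in> fock" "(\<lambda>n. fock_norm (f - g n)) \<longlonglongrightarrow> 0"
  shows "(\<lambda>n. g n z) \<longlonglongrightarrow> f z"
proof -
  have "cmod (f z - g n z) \<le> (exp ((cmod z)\<^sup>2 / 2) / fock_norm (\<lambda>_. 1)) * fock_norm (f - g n)" for n
    using fock_eval_le[OF fock_diff_closed[OF assms(2,1)], of n z] fock_norm_one_pos
    by (simp add: field_simps)
  moreover have "(\<lambda>n. (exp ((cmod z)\<^sup>2 / 2) / fock_norm (\<lambda>_. 1)) * fock_norm (f - g n)) \<longlonglongrightarrow> 0"
    by (rule tendsto_mult_right_zero[OF assms(3)])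
  ultimately have "(\<lambda>n. f z - g n z) \<longlonglongrightarrow> 0"
    by (intro Lim_null_comparison[where f = "\<lambda>n. f z - g n z"] always_eventually) auto
  then have "(\<lambda>n. f z - (f z - g n z)) \<longlonglongrightarrow> f z - 0"
    by (intro tendsto_intros)
  then show ?thesis by simp
qed

lemma taylor_coeff_tendsto:
  assumes "\<And>n. g n \<in> fock" "f \<in> fock" "(\<lambda>n. fock_norm (f - g n)) \<longlonglongrightarrow> 0"
  shows "(\<lambda>n. taylor_coeff (g n) k) \<longlonglongrightarrow> taylor_coeff f k"
proof -
  have "cmod (taylor_coeff f k - taylor_coeff (g n) k) \<le> (1 / fock_norm (\<lambda>z. z ^ k)) * fock_norm (f - g n)" for n
    using taylor_coeff_le[OF fock_diff_closed[OF assms(2,1)], of n k] fock_norm_power_pos[of k]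
    by (simp add: field_simps taylor_coeff_diff fock_holomorphic assms)
  moreover have "(\<lambda>n. (1 / fock_norm (\<lambda>z. z ^ k)) * fock_norm (f - g n)) \<longlonglongrightarrow> 0"
    by (rule tendsto_mult_right_zero[OF assms(3)])
  ultimately have "(\<lambda>n. taylor_coeff f k - taylor_coeff (g n) k) \<longlonglongrightarrow> 0"
    by (intro Lim_null_comparison[where f = "\<lambda>n. taylor_coeff f k - taylor_coeff (g n) k"] always_eventually) auto
  then have "(\<lambda>n. taylor_coeff f k - (taylor_coeff f k - taylor_coeff (g n) k)) \<longlonglongrightarrow> taylor_coeff f k - 0"
    by (intro tendsto_intros)
  then show ?thesis by simp
qed

section \<open>Boundedness and failure of supercyclicity\<close>

lemma fock_closure_iff:
  "f \<in> fock.mtopology closure_of S \<longleftrightarrow>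
    f \<in> fock \<and> (\<forall>e>0. \<exists>g\<in>S. g \<in> fock \<and> fock_norm (f - g) < e)"
  by (auto simp: fock.metric_closure_of fock_dist_def)

lemma fock_dense_iff:
  "fock_dense S \<longleftrightarrow> S \<subseteq> fock \<and> (\<forall>f\<in>fock. \<forall>e>0. \<exists>g\<in>S. fock_norm (f - g) < e)"
proof -
  have "S \<subseteq> fock \<Longrightarrow> fock.mtopology closure_of S = fock
      \<longleftrightarrow> (\<forall>f\<in>fock. \<forall>e>0. \<exists>g\<in>S. fock_norm (f - g) < e)"
    unfolding set_eq_iff fock_closure_iff by blast
  then show ?thesis by (auto simp: fock_dense_def)
qed

lemma fock_dense_sequence:
  assumes "fock_dense S" "f \<in> fock"
  obtains g where "\<And>n. g n \<in> S" "\<And>n. g n \<in> fock" "(\<lambda>n. fock_norm (f - g n)) \<longlonglongrightarrow> 0"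
proof -
  have "\<exists>g\<in>S. fock_norm (f - g) < 1 / real (Suc n)" for n
    using assms by (auto simp: fock_dense_iff)
  then obtain g where g: "\<And>n. g n \<in> S" "\<And>n. fock_norm (f - g n) < 1 / real (Suc n)"
    by metis
  have "(\<lambda>n. fock_norm (f - g n)) \<longlonglongrightarrow> 0"
    using g(2) fock_norm_nonneg
    by (intro tendsto_sandwich[OF _ _ tendsto_const LIMSEQ_inverse_real_of_nat] always_eventually)
       (auto simp: inverse_eq_divide less_imp_le)
  with g(1) assms(1) show ?thesis
    by (intro that[of g]) (auto simp: fock_dense_iff)
qed

lemma taylor_coeff_relation_dense:
  assumes "fock_dense S"
    and "\<And>g. g \<in> S \<Longrightarrow> A * taylor_coeff g j = B * taylor_coeff g k"
    and f: "f \<in> fock"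
  shows "A * taylor_coeff f j = B * taylor_coeff f k"
proof -
  obtain g where g: "\<And>n. g n \<in> S" "\<And>n. g n \<in> fock" "(\<lambda>n. fock_norm (f - g n)) \<longlonglongrightarrow> 0"
    using fock_dense_sequence[OF assms(1) f] by blast
  have 1: "(\<lambda>n. A * taylor_coeff (g n) j) \<longlonglongrightarrow> A * taylor_coeff f j"
    and 2: "(\<lambda>n. B * taylor_coeff (g n) k) \<longlonglongrightarrow> B * taylor_coeff f k"
    by (intro tendsto_intros taylor_coeff_tendsto g f)+
  show ?thesis
    by (rule LIMSEQ_unique[OF 1[unfolded assms(2)[OF g(1)]] 2])
qed

text \<open>The inequality is homogeneous in \<open>g\<close>, so it tolerates the arbitrary scalars
  of a projective orbit, and it is closed because evaluations are norm continuous.\<close>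

lemma eval_inequality_dense:
  assumes "fock_dense S"
    and "\<And>g. g \<in> S \<Longrightarrow> cmod (g q) * A \<le> M * cmod (g p)"
    and f: "f \<in> fock"
  shows "cmod (f q) * A \<le> M * cmod (f p)"
proof -
  obtain g where g: "\<And>n. g n \<in> S" "\<And>n. g n \<in> fock" "(\<lambda>n. fock_norm (f - g n)) \<longlonglongrightarrow> 0"
    using fock_dense_sequence[OF assms(1) f] by blast
  show ?thesis
  proof (rule LIMSEQ_le)
    show "(\<lambda>n. cmod (g n q) * A) \<longlonglongrightarrow> cmod (f q) * A" "(\<lambda>n. M * cmod (g n p)) \<longlonglongrightarrow> M * cmod (f p)"
      by (intro tendsto_intros fock_eval_tendsto g f)+
  qed (use assms(2) g(1) in auto)
qed

lemma fock_affine: "(\<lambda>z. z - p) \<in> fock"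
  using fock_diff_closed[OF fock_power[of 1] fock_const[of p]] by (simp add: fun_diff_def)

text \<open>If \<open>f p \<noteq> 0\<close>, the elements of the projective orbit satisfy an inequality between
  their values at \<open>p\<close> and \<open>q\<close> which \<open>z - p\<close> violates; if \<open>f p = 0\<close> they all vanish at \<open>p\<close>.\<close>

lemma not_fock_dense_eval:
  assumes "p \<noteq> q" and "\<And>g. g \<in> S \<Longrightarrow> \<exists>c h. g p = c * f p \<and> g q = c * h \<and> cmod h \<le> M"
  shows "\<not> fock_dense S"
proof
  assume dense: "fock_dense S"
  have ineq: "cmod (g q) * cmod (f p) \<le> M * cmod (g p)" if gS: "g \<in> S" for g
  proof -
    obtain c h where "g p = c * f p" "g q = c * h" "cmod h \<le> M"
      using assms(2)[OF gS] by blast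
    then show ?thesis
      using mult_right_mono[of "cmod h" M "cmod c * cmod (f p)"] by (simp add: norm_mult mult_ac)
  qed
  have "cmod (q - p) * cmod (f p) \<le> M * cmod (p - p)"
    by (rule eval_inequality_dense[OF dense ineq fock_affine]) auto
  then have "cmod (f p) \<le> 0" using assms(1) by (simp add: mult_le_0_iff)
  then have "f p = 0" by simp
  \<comment> \<open>Vanishing at \<open>p\<close> is written as an instance of the same inequality,
    with both points equal to \<open>p\<close>; the constant function 1 refutes it.\<close>
  then have "cmod (g p) * 1 \<le> 0 * cmod (g p)" if "g \<in> S" for g
    using assms(2)[OF that] by auto
  then have "cmod ((\<lambda>_. 1) p) * 1 \<le> 0 * cmod ((\<lambda>_. 1) p)"
    by (rule eval_inequality_dense[OF dense _ fock_const])
  then show False by simp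
qed

section \<open>Iterates of affine symbols and projective orbits\<close>

lemma comp_op_funpow: "(comp_op \<psi> ^^ n) f = (\<lambda>z. f ((\<psi> ^^ n) z))"
proof (induction n)
  case (Suc n)
  then show ?case by (simp add: comp_op_def o_def funpow_swap1)
qed simp

lemma affine_funpow_fixed_point:
  fixes a b p :: complex
  assumes "a * p + b = p"
  shows "((\<lambda>z. a * z + b) ^^ n) z = p + a ^ n * (z - p)"
proof (induction n)
  case (Suc n)
  have "((\<lambda>z. a * z + b) ^^ Suc n) z = a * (p + a ^ n * (z - p)) + b"
    by (simp add: Suc.IH)
  also have "\<dots> = (a * p + b) + a ^ Suc n * (z - p)"
    by (simp add: algebra_simps)
  finally show ?case by (simp only: assms)
qed simp

text \<open>Only a nonzero translation lacks a fixed point, and the condition on \<open>b\<close>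
  excludes it.\<close>

lemma affine_fixed_point_exists:
  fixes a b :: complex
  assumes "cmod a \<le> 1" "cmod a = 1 \<longrightarrow> b = 0"
  obtains p where "a * p + b = p"
proof (cases "a = 1")
  case True
  then show ?thesis using assms that[of 0] by simp
next
  case False
  then show ?thesis by (intro that[of "b / (1 - a)"]) (simp add: field_simps)
qed

lemma fock_boundedE:
  assumes "fock_bounded T"
  obtains C where "\<And>f. f \<in> fock \<Longrightarrow> fock_norm (T f) \<le> C * fock_norm f"
    "\<And>f. f \<in> fock \<Longrightarrow> T f \<in> fock"
proof -
  have "T \<in> fock \<rightarrow> fock" "\<exists>C. \<forall>f\<in>fock. fock_norm (T f) \<le> C * fock_norm f"
    using assms by (simp_all add: fock_bounded_def)
  then show ?thesis using that by auto
qed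

text \<open>All iterates of the symbol fix p and send p + 1 to p + a^n, which stays in the closed
  unit disc about p. As \<open>f\<close> is bounded on this disc, \<open>not_fock_dense_eval\<close>
  applies.\<close>

lemma not_supercyclic_comp_op:
  assumes a: "cmod a \<le> 1" "cmod a = 1 \<longrightarrow> b = 0"
  shows "\<not> supercyclic (comp_op (\<lambda>z. a * z + b))"
proof
  assume "supercyclic (comp_op (\<lambda>z. a * z + b))"
  then obtain f where f: "f \<in> fock"
    and dense: "fock_dense {cscale c ((comp_op (\<lambda>z. a * z + b) ^^ n) f) | c n. True}"
    by (auto simp: supercyclic_def)
  obtain p where p: "a * p + b = p" using affine_fixed_point_exists[OF a] .
  have "bounded (f ` cball p 1)"
    using fock_holomorphic[OF f]
    by (intro compact_imp_bounded compact_continuous_image)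
       (auto intro: continuous_on_subset holomorphic_on_imp_continuous_on)
  then obtain M where "\<forall>y\<in>f ` cball p 1. cmod y \<le> M" unfolding bounded_iff by blast
  then have M: "cmod (f z) \<le> M" if "z \<in> cball p 1" for z using that by blast
  have "\<not> fock_dense {cscale c ((comp_op (\<lambda>z. a * z + b) ^^ n) f) | c n. True}"
  proof (rule not_fock_dense_eval[of p "p + 1" _ f M])
    fix g assume "g \<in> {cscale c ((comp_op (\<lambda>z. a * z + b) ^^ n) f) | c n. True}"
    then obtain c n where g: "g = cscale c ((comp_op (\<lambda>z. a * z + b) ^^ n) f)" by blast
    have "cmod (f (p + a ^ n)) \<le> M"
      using a by (intro M) (auto simp: dist_norm norm_power power_le_one)
    then show "\<exists>c h. g p = c * f p \<and> g (p + 1) = c * h \<and> cmod h \<le> M"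
      by (intro exI[of _ c] exI[of _ "f (p + a ^ n)"])
         (auto simp: g cscale_def comp_op_funpow affine_funpow_fixed_point[OF p])
  qed simp
  with dense show False by blast
qed

section \<open>Bounded composition operators and bounded multipliers\<close>

text \<open>If |a| = 1, dilation keeps the modulus of every coefficient, so the operator is
  isometric. If |a| < 1, the pointwise bound on f(az+b) grows strictly slower than exp(|z|^2), and
  \<open>fock_growth\<close> applies.\<close>

lemma fock_bounded_comp_op_affine:
  assumes a: "cmod a \<le> 1" "cmod a = 1 \<longrightarrow> b = 0"
  shows "fock_bounded (comp_op (\<lambda>z. a * z + b))"
proof -
  have hol: "comp_op (\<lambda>z. a * z + b) f holomorphic_on UNIV" if "f \<in> fock" for f
    unfolding comp_op_def o_def
    by (intro holomorphic_compose_UNIV[OF fock_holomorphic[OF that]] holomorphic_intros)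
  have "\<exists>C. \<forall>f\<in>fock. comp_op (\<lambda>z. a * z + b) f \<in> fock
      \<and> fock_norm (comp_op (\<lambda>z. a * z + b) f) \<le> C * fock_norm f"
  proof (cases "cmod a = 1")
    case True
    have "comp_op (\<lambda>z. a * z + b) f \<in> fock
      \<and> fock_norm (comp_op (\<lambda>z. a * z + b) f) \<le> 1 * fock_norm f" if f: "f \<in> fock" for f
    proof -
      have eq: "comp_op (\<lambda>z. a * z + b) f = (\<lambda>z. f (a * z))"
        using True a by (auto simp: comp_op_def)
      note coeff = taylor_coeff_dilate[OF fock_holomorphic[OF f], of a]
      \<comment> \<open>The extended identity comes first since membership of the dilated function
        is not yet known.\<close>
      have "(\<integral>\<^sup>+z. ennreal ((cmod (f (a * z)))\<^sup>2) \<partial>gauss_measure)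
          = (\<integral>\<^sup>+z. ennreal ((cmod (f z))\<^sup>2) \<partial>gauss_measure)"
        using True hol[OF f] nn_integral_gauss_norm2[OF fock_holomorphic[OF f]]
        unfolding eq by (subst nn_integral_gauss_norm2) (auto simp: coeff norm_mult norm_power)
      note nn = this
      have mem: "(\<lambda>z. f (a * z)) \<in> fock"
        using f hol[OF f] nn fock_iff_nn_integral[OF fock_holomorphic[OF f]]
          fock_iff_nn_integral[of "\<lambda>z. f (a * z)"]
        unfolding eq by simp
      have "(fock_norm (\<lambda>z. f (a * z)))\<^sup>2 = (fock_norm f)\<^sup>2"
        using nn unfolding fock_norm_nn_integral[OF mem, symmetric] fock_norm_nn_integral[OF f, symmetric]
        by simp
      then show ?thesis
        unfolding eq using mem fock_norm_nonneg by (simp add: power2_eq_iff_nonneg)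
    qed
    then show ?thesis by blast
  next
    case False
    define r where "r = cmod a"
    have r: "0 \<le> r" "r < 1" using a False by (auto simp: r_def)
    \<comment> \<open>This \<open>d\<close> gives r + d = (1+r)/2 < 1 and thereby r^2 (1+d) < 1. It
      is the weight in |az+b|^2 \<le> (1+d)|az|^2 + (1+1/d)|b|^2, whose second term goes into
      \<open>E\<close>.\<close>
    define d where "d = (1 - r) / 2"
    have d: "d > 0" "d < 1" "r + d < 1" using r by (auto simp: d_def field_simps)
    define E where "E = exp ((cmod b)\<^sup>2 * (1 + 1 / d)) / (fock_norm (\<lambda>_. 1))\<^sup>2"
    have E: "E \<ge> 0" by (simp add: E_def)
    have q: "r\<^sup>2 * (1 + d) < 1"
    proof -
      have "r\<^sup>2 * (1 + d) \<le> r * (1 + d)"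
        using r d by (intro mult_right_mono) (auto simp: power2_eq_square mult_left_le)
      also have "\<dots> \<le> r + d" using r d by (simp add: distrib_left mult_left_le_one_le)
      finally show ?thesis using d by simp
    qed
    obtain J where J: "J \<ge> 0" "\<And>f B. f holomorphic_on UNIV \<Longrightarrow> B \<ge> 0
      \<Longrightarrow> (\<And>z. (cmod (f z))\<^sup>2 \<le> B * exp (r\<^sup>2 * (1 + d) * (cmod z)\<^sup>2))
      \<Longrightarrow> f \<in> fock \<and> (fock_norm f)\<^sup>2 \<le> B * J"
      using fock_growth[OF q] by blast
    have "comp_op (\<lambda>z. a * z + b) f \<in> fock
      \<and> fock_norm (comp_op (\<lambda>z. a * z + b) f) \<le> sqrt (E * J) * fock_norm f" if f: "f \<in> fock" for f
    proof -
      have "(cmod (comp_op (\<lambda>z. a * z + b) f z))\<^sup>2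
          \<le> (E * (fock_norm f)\<^sup>2) * exp (r\<^sup>2 * (1 + d) * (cmod z)\<^sup>2)" for z
      proof -
        have "cmod (f (a * z + b)) \<le> exp ((cmod (a * z + b))\<^sup>2 / 2) * fock_norm f / fock_norm (\<lambda>_. 1)"
          using fock_eval_le[OF f, of "a * z + b"] fock_norm_one_pos by (simp add: field_simps)
        then have "(cmod (f (a * z + b)))\<^sup>2 \<le> (exp ((cmod (a * z + b))\<^sup>2 / 2) * fock_norm f / fock_norm (\<lambda>_. 1))\<^sup>2"
          by (rule power_mono) simp
        also have "\<dots> = exp ((cmod (a * z + b))\<^sup>2) * (fock_norm f)\<^sup>2 / (fock_norm (\<lambda>_. 1))\<^sup>2"
          by (simp add: power_mult_distrib power_divide flip: exp_double)
        also have "\<dots> \<le> exp ((1 + d) * (cmod (a * z))\<^sup>2 + (1 + 1 / d) * (cmod b)\<^sup>2) * (fock_norm f)\<^sup>2 / (fock_norm (\<lambda>_. 1))\<^sup>2"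
          using cmod_add_power2_le[OF d(1), of "a * z" b]
          by (intro divide_right_mono mult_right_mono) auto
        also have "\<dots> = (E * (fock_norm f)\<^sup>2) * exp (r\<^sup>2 * (1 + d) * (cmod z)\<^sup>2)"
          by (simp add: E_def exp_add r_def norm_mult power_mult_distrib mult_ac)
        finally show ?thesis by (simp add: comp_op_def)
      qed
      then have *: "comp_op (\<lambda>z. a * z + b) f \<in> fock
          \<and> (fock_norm (comp_op (\<lambda>z. a * z + b) f))\<^sup>2 \<le> (E * (fock_norm f)\<^sup>2) * J"
        using E by (intro J hol f) auto
      have "(sqrt (E * J) * fock_norm f)\<^sup>2 = (E * (fock_norm f)\<^sup>2) * J"
        using E J(1) by (simp add: power_mult_distrib)
      with * show ?thesis
        by (metis E J(1) fock_norm_nonneg mult_nonneg_nonneg power2_le_imp_le real_sqrt_ge_zero)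
    qed
    then show ?thesis by blast
  qed
  then show ?thesis
    by (auto simp: fock_bounded_def comp_op_def cscale_def plus_fun_def o_def)
qed

lemma fock_kernel_diag: "fock_kernel z z = of_real (exp ((cmod z)\<^sup>2))"
  by (simp add: fock_kernel_def complex_norm_square[symmetric] exp_of_real del: of_real_power)

text \<open>Evaluate the image of the kernel at \<psi>(z) in z: the value is exp(|\<psi>(z)|^2),
  whereas the norm of the kernel contributes only the square root of this. Taking logarithms gives
  \<open>growth\<close>.\<close>

lemma fock_bounded_comp_op_imp_affine:
  assumes hol: "\<psi> holomorphic_on UNIV" and bdd: "fock_bounded (comp_op \<psi>)"
  obtains a b where "\<psi> = (\<lambda>z. a * z + b)" "cmod a \<le> 1" "cmod a = 1 \<longrightarrow> b = 0"
proof -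
  obtain C where C: "\<And>f. f \<in> fock \<Longrightarrow> fock_norm (comp_op \<psi> f) \<le> C * fock_norm f"
    and maps: "\<And>f. f \<in> fock \<Longrightarrow> comp_op \<psi> f \<in> fock"
    using fock_boundedE[OF bdd] by blast
  \<comment> \<open>The maximum makes ln K nonnegative, so that the square root of \<open>L\<close>
    can be used below.\<close>
  define K where "K = max C 1"
  have K: "K \<ge> 1" by (simp add: K_def)
  have growth: "(cmod (\<psi> z))\<^sup>2 \<le> (cmod z)\<^sup>2 + 2 * ln K" for z
  proof -
    define w where "w = (cmod (\<psi> z))\<^sup>2 / 2"
    let ?n = "fock_norm (\<lambda>_. 1)"
    have "cmod (comp_op \<psi> (fock_kernel (\<psi> z)) z) * ?n
        \<le> exp ((cmod z)\<^sup>2 / 2) * fock_norm (comp_op \<psi> (fock_kernel (\<psi> z)))"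
      by (rule fock_eval_le[OF maps[OF fock_kernel_in_fock]])
    also have "\<dots> \<le> exp ((cmod z)\<^sup>2 / 2) * (K * fock_norm (fock_kernel (\<psi> z)))"
      by (intro mult_left_mono order.trans[OF C[OF fock_kernel_in_fock]])
         (auto simp: K_def fock_norm_nonneg intro!: mult_right_mono)
    also have "fock_norm (fock_kernel (\<psi> z)) = exp w * ?n"
      by (simp add: fock_norm_kernel w_def)
    also have "comp_op \<psi> (fock_kernel (\<psi> z)) z = of_real (exp (2 * w))"
      by (simp add: comp_op_def fock_kernel_diag w_def)
    finally have "exp (2 * w) * ?n \<le> (exp ((cmod z)\<^sup>2 / 2) * K * exp w) * ?n"
      by (simp add: mult_ac)
    then have "exp (2 * w) \<le> exp ((cmod z)\<^sup>2 / 2) * K * exp w"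
      using fock_norm_one_pos by simp
    also have "\<dots> = exp ((cmod z)\<^sup>2 / 2 + ln K + w)"
      using K by (simp add: exp_add)
    finally show ?thesis by (simp add: w_def)
  qed
  define L where "L = 2 * ln K"
  have L: "L \<ge> 0" using K by (simp add: L_def)
  have "cmod (\<psi> z) \<le> (1 + sqrt L) * cmod z ^ 1" if "1 \<le> cmod z" for z
  proof -
    have "(cmod (\<psi> z))\<^sup>2 \<le> (cmod z)\<^sup>2 + L" using growth[of z] by (simp add: L_def)
    also have "\<dots> \<le> (cmod z + sqrt L)\<^sup>2" using L by (simp add: power2_sum)
    finally have "cmod (\<psi> z) \<le> cmod z + sqrt L"
      by (rule power2_le_imp_le) (use L in auto)
    also have "sqrt L \<le> sqrt L * cmod z" using L that by (simp add: mult_le_cancel_left1)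
    finally show ?thesis by (simp add: algebra_simps)
  qed
  then have Liouville: "\<psi> z = (\<Sum>k\<le>1. (deriv ^^ k) \<psi> 0 / fact k * z ^ k)" for z
    by (rule Liouville_polynomial[OF hol])
  define a b where "a = deriv \<psi> 0" "b = \<psi> 0"
  have \<psi>_eq: "\<psi> = (\<lambda>z. a * z + b)"
    by (rule ext, subst Liouville) (simp add: a_b_def)
  \<comment> \<open>On a line through 0 the growth bound is a real quadratic inequality in
    \<open>t\<close>; both conditions on \<open>a\<close> and \<open>b\<close> follow by choosing
    \<open>t\<close> and the direction \<theta>.\<close>
  have lin: "(cmod a)\<^sup>2 * t\<^sup>2 + 2 * (t * Re (a * cnj b * cis \<theta>)) + (cmod b)\<^sup>2 \<le> t\<^sup>2 + L" for t \<theta>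
  proof -
    have "(cmod (a * (of_real t * cis \<theta>) + b))\<^sup>2
        = (cmod (a * (of_real t * cis \<theta>)))\<^sup>2 + 2 * Re (a * (of_real t * cis \<theta>) * cnj b) + (cmod b)\<^sup>2"
      unfolding cmod_power2 by (simp add: power2_eq_square algebra_simps)
    moreover have "(cmod (a * (of_real t * cis \<theta>)))\<^sup>2 = (cmod a)\<^sup>2 * t\<^sup>2"
      by (simp add: norm_mult power_mult_distrib)
    moreover have "Re (a * (of_real t * cis \<theta>) * cnj b) = t * Re (a * cnj b * cis \<theta>)"
      by (simp add: algebra_simps)
    moreover have "(cmod (of_real t * cis \<theta>))\<^sup>2 = t\<^sup>2"
      by (simp add: norm_mult)
    moreover have "(cmod (a * (of_real t * cis \<theta>) + b))\<^sup>2 \<le> (cmod (of_real t * cis \<theta>))\<^sup>2 + L"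
      using growth[of "of_real t * cis \<theta>"] by (simp add: \<psi>_eq L_def)
    ultimately show ?thesis by linarith
  qed
  show ?thesis
  proof (rule that[OF \<psi>_eq])
    show "cmod a \<le> 1"
    proof (rule ccontr)
      assume "\<not> cmod a \<le> 1"
      define s where "s = (cmod a)\<^sup>2 - 1"
      have s: "s > 0" using \<open>\<not> cmod a \<le> 1\<close> by (simp add: s_def)
      define m where "m = Re (a * cnj b * cis 0)"
      \<comment> \<open>Chosen so that s t = 2|m| + L + 1 + s: then s t^2 absorbs the cross term and
        still leaves at least L + 1 + s. The final summand 1 ensures t \<ge> 1.\<close>
      define t where "t = (2 * \<bar>m\<bar> + L + 1) / s + 1"
      have t: "t \<ge> 1" using s L by (simp add: t_def)
      have st: "s * t = 2 * \<bar>m\<bar> + L + 1 + s" using s by (simp add: t_def field_simps)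
      have "s * t\<^sup>2 = (s * t) * t" by (simp add: power2_eq_square)
      also have "\<dots> = 2 * (t * \<bar>m\<bar>) + (L + 1 + s) * t" unfolding st by (simp add: algebra_simps)
      finally have 1: "s * t\<^sup>2 = 2 * (t * \<bar>m\<bar>) + (L + 1 + s) * t" .
      have 2: "L + 1 + s \<le> (L + 1 + s) * t" using t s L mult_left_mono[of 1 t "L + 1 + s"] by simp
      have 3: "- (t * \<bar>m\<bar>) \<le> t * m"
        using t mult_left_mono[of "- \<bar>m\<bar>" m t] by simp
      have "(cmod a)\<^sup>2 * t\<^sup>2 = s * t\<^sup>2 + t\<^sup>2" by (simp add: s_def algebra_simps)
      then have "s * t\<^sup>2 + 2 * (t * m) + (cmod b)\<^sup>2 \<le> L"
        using lin[of t 0] by (simp add: m_def)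
      moreover have False
        if "P + 2 * Q + R \<le> L" "P = 2 * Y + X" "L + 1 + s \<le> X" "- Y \<le> Q" "0 \<le> R" for P Q R X Y :: real
        using that s by linarith
      ultimately show False using 1 2 3 zero_le_power2[of "cmod b"] by blast
    qed
    show "cmod a = 1 \<longrightarrow> b = 0"
    proof (intro impI, rule ccontr)
      assume a1: "cmod a = 1" and b0: "b \<noteq> 0"
      define c where "c = a * cnj b"
      have c: "cmod c > 0" using a1 b0 by (simp add: c_def norm_mult)
      \<comment> \<open>This direction makes the cross term positive. With t = L/|c| it equals 2L,
        the terms in t^2 cancel because |a| = 1, and 2L + |b|^2 \<le> L is absurd.\<close>
      have "c * cis (- Arg c) = of_real (cmod c)"
      proof -
        have "c * cis (- Arg c) = rcis (cmod c) (Arg c) * cis (- Arg c)"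
          by (simp add: rcis_cmod_Arg)
        also have "\<dots> = of_real (cmod c)"
          by (simp add: rcis_def cis_mult mult.assoc)
        finally show ?thesis .
      qed
      then have "(cmod a)\<^sup>2 * (L / cmod c)\<^sup>2 + 2 * (L / cmod c * cmod c) + (cmod b)\<^sup>2 \<le> (L / cmod c)\<^sup>2 + L"
        using lin[of "L / cmod c" "- Arg c"] by (simp add: c_def)
      then have "2 * L + (cmod b)\<^sup>2 \<le> L" using a1 c by simp
      then show False using L b0 by (smt (verit) zero_less_power2 norm_eq_zero)
    qed
  qed
qed

lemma not_cyclic_mult_op:
  assumes hol: "u holomorphic_on UNIV" and bdd: "fock_bounded (mult_op u)"
  shows "\<not> cyclic (mult_op u)"
proof
  assume "cyclic (mult_op u)"
  then obtain f where dense: "fock_dense (cfun.span (range (\<lambda>n. (mult_op u ^^ n) f)))"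
    by (auto simp: cyclic_def cyclic_vector_def)
  obtain C where C: "\<And>f. f \<in> fock \<Longrightarrow> fock_norm (mult_op u f) \<le> C * fock_norm f"
    and maps: "\<And>f. f \<in> fock \<Longrightarrow> mult_op u f \<in> fock"
    using fock_boundedE[OF bdd] by blast
  \<comment> \<open>The kernel at \<open>z\<close> attains the evaluation bound at \<open>z\<close>
    exactly, so both exponential factors and the norm of 1 cancel and the operator bound
    \<open>C\<close> survives.\<close>
  have "cmod (u z) \<le> C" for z
  proof -
    define E where "E = exp ((cmod z)\<^sup>2 / 2)"
    let ?n = "fock_norm (\<lambda>_. 1)"
    have E: "E > 0" by (simp add: E_def)
    have "cmod (mult_op u (fock_kernel z) z) * ?n \<le> E * fock_norm (mult_op u (fock_kernel z))"
      unfolding E_def by (rule fock_eval_le[OF maps[OF fock_kernel_in_fock]])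
    also have "\<dots> \<le> E * (C * fock_norm (fock_kernel z))"
      using E by (intro mult_left_mono C fock_kernel_in_fock) auto
    also have "fock_norm (fock_kernel z) = E * ?n"
      by (simp add: fock_norm_kernel E_def)
    also have "mult_op u (fock_kernel z) z = u z * of_real (exp ((cmod z)\<^sup>2))"
      by (simp add: mult_op_def fock_kernel_diag)
    also have "exp ((cmod z)\<^sup>2) = E * E"
      by (simp add: E_def exp_add[symmetric])
    finally show ?thesis
      using E fock_norm_one_pos by (simp add: norm_mult)
  qed
  then have "u constant_on UNIV"
    by (intro Liouville_theorem[OF hol]) (auto simp: bounded_iff)
  then obtain c where u: "u = (\<lambda>_. c)" by (auto simp: constant_on_def)
  have pow: "(mult_op u ^^ n) f = cscale (c ^ n) f" for n
    by (induction n) (simp_all add: mult_op_def cscale_def u fun_eq_iff)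
  \<comment> \<open>The span of the orbit lies in the line through \<open>f\<close>, where the
    values at 0 and 1 are d f(0) and d f(1) with a common scalar d.\<close>
  have "\<not> fock_dense (cfun.span (range (\<lambda>n. (mult_op u ^^ n) f)))"
  proof (rule not_fock_dense_eval[of 0 1 _ f "cmod (f 1)"])
    fix g assume "g \<in> cfun.span (range (\<lambda>n. (mult_op u ^^ n) f))"
    also have "\<dots> \<subseteq> cfun.span {f}"
      by (intro cfun.span_minimal cfun.subspace_span) (auto simp: pow intro: cfun.span_scale cfun.span_base)
    finally obtain d where "g = cscale d f"
      by (auto simp: cfun.span_singleton)
    then show "\<exists>c h. g 0 = c * f 0 \<and> g 1 = c * h \<and> cmod h \<le> cmod (f 1)"
      by (intro exI[of _ d] exI[of _ "f 1"]) (auto simp: cscale_def)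
  qed simp
  with dense show False by blast
qed

section \<open>Cyclicity\<close>

text \<open>Closure is idempotent, so the approximants may themselves lie in the closure; monomials
  already obtained as limits can be reused.\<close>

lemma fock_closure_sequence:
  assumes "\<And>n. g n \<in> fock.mtopology closure_of S" "f \<in> fock" "(\<lambda>n. fock_norm (f - g n)) \<longlonglongrightarrow> 0"
  shows "f \<in> fock.mtopology closure_of S"
proof -
  have "f \<in> fock.mtopology closure_of (fock.mtopology closure_of S)"
    unfolding fock_closure_iff[of f "fock.mtopology closure_of S"]
  proof (intro conjI allI impI assms(2))
    fix e :: real assume "e > 0"
    then obtain n where "fock_norm (f - g n) < e"
      using order_tendstoD(2)[OF assms(3)] eventually_happens'[OF sequentially_bot] by blast
    moreover have "g n \<in> fock" using assms(1)[of n] by (simp add: fock_closure_iff)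
    ultimately show "\<exists>g\<in>fock.mtopology closure_of S. g \<in> fock \<and> fock_norm (f - g) < e"
      using assms(1) by blast
  qed
  then show ?thesis by simp
qed

lemma fock_norm_scale: "fock_norm (cscale c f) = cmod c * fock_norm f"
  by (simp add: fock_norm_eq cscale_def norm_mult power_mult_distrib real_sqrt_mult)

lemma subspace_fock_closure:
  assumes S: "cfun.subspace S" "S \<subseteq> fock"
  shows "cfun.subspace (fock.mtopology closure_of S)"
  unfolding cfun.subspace_def
proof (intro conjI ballI allI)
  have sub: "S \<subseteq> fock.mtopology closure_of S"
    using S(2) by (intro closure_of_subset) simp
  then show "0 \<in> fock.mtopology closure_of S"
    using cfun.subspace_0[OF S(1)] by blast
  fix f assume f: "f \<in> fock.mtopology closure_of S"
  then have fF: "f \<in> fock" by (simp add: fock_closure_iff)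
  {
    fix g assume g: "g \<in> fock.mtopology closure_of S"
    then have gF: "g \<in> fock" by (simp add: fock_closure_iff)
    show "f + g \<in> fock.mtopology closure_of S"
      unfolding fock_closure_iff
    proof (intro conjI allI impI fock_add_closed[OF fF gF])
      fix e :: real assume "e > 0"
      then have "e / 2 > 0" by simp
      then obtain u v where u: "u \<in> S" "fock_norm (f - u) < e / 2" and v: "v \<in> S" "fock_norm (g - v) < e / 2"
        using f g unfolding fock_closure_iff by blast
      have "fock_norm ((f - u) + (g - v)) \<le> fock_norm (f - u) + fock_norm (g - v)"
        using u v S(2) fF gF by (intro fock_norm_triangle fock_diff_closed) auto
      then have "fock_norm (f + g - (u + v)) < e"
        using u v by (simp add: algebra_simps)
      moreover have "u + v \<in> S" using u v cfun.subspace_add[OF S(1)] by blast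
      ultimately show "\<exists>h\<in>S. h \<in> fock \<and> fock_norm (f + g - h) < e"
        using S(2) by blast
    qed
  }
  fix c
  show "cscale c f \<in> fock.mtopology closure_of S"
    unfolding fock_closure_iff
  proof (intro conjI allI impI fock_scale_closed[OF fF])
    fix e :: real assume e: "e > 0"
    \<comment> \<open>Adding 1 covers the scalar c = 0.\<close>
    then have "e / (cmod c + 1) > 0" by (simp add: add_nonneg_pos)
    then obtain u where u: "u \<in> S" "fock_norm (f - u) < e / (cmod c + 1)"
      using f unfolding fock_closure_iff by blast
    have "cscale c f - cscale c u = cscale c (f - u)"
      by (rule cfun.scale_right_diff_distrib[symmetric])
    then have "fock_norm (cscale c f - cscale c u) = cmod c * fock_norm (f - u)"
      by (simp add: fock_norm_scale)
    also have "\<dots> \<le> (cmod c + 1) * fock_norm (f - u)"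
      by (simp add: distrib_right fock_norm_nonneg)
    also have "\<dots> < e" using u by (simp add: less_divide_eq add_nonneg_pos mult.commute split: if_splits)
    finally show "\<exists>h\<in>S. h \<in> fock \<and> fock_norm (cscale c f - h) < e"
      using cfun.subspace_scale[OF S(1) u(1)] S(2) by blast
  qed
qed

lemma holomorphic_sum_UNIV:
  "(\<And>i. i \<in> I \<Longrightarrow> f i holomorphic_on UNIV) \<Longrightarrow> (\<Sum>i\<in>I. f i) holomorphic_on (UNIV :: complex set)"
proof (induction I rule: infinite_finite_induct)
  case (insert i I)
  then show ?case by (simp add: plus_fun_def holomorphic_on_add)
qed (auto simp: zero_fun_def)

lemma taylor_coeff_sum:
  "(\<And>i. i \<in> I \<Longrightarrow> f i holomorphic_on UNIV) \<Longrightarrow> taylor_coeff (\<Sum>i\<in>I. f i) k = (\<Sum>i\<in>I. taylor_coeff (f i) k)"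
proof (induction I rule: infinite_finite_induct)
  case (insert i I)
  then have "taylor_coeff (f i + (\<Sum>i\<in>I. f i)) k = taylor_coeff (f i) k + taylor_coeff (\<Sum>i\<in>I. f i) k"
    by (intro taylor_coeff_add holomorphic_sum_UNIV) auto
  with insert show ?case by (simp only: sum.insert insert_iff simp_thms)
qed (use taylor_coeff_const[of 0 k] in \<open>auto simp: zero_fun_def\<close>)

text \<open>The Taylor partial sums of \<open>f\<close> lie in the closure, and their coefficients
  are dominated by those of \<open>f\<close>, so they converge to \<open>f\<close> in norm.\<close>

lemma fock_dense_if_powers:
  assumes S: "cfun.subspace S" "S \<subseteq> fock"
    and pow: "\<And>k. (\<lambda>z. z ^ k) \<in> fock.mtopology closure_of S"
  shows "fock_dense S"
proof -
  have "f \<in> fock.mtopology closure_of S" if f: "f \<in> fock" for f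
  proof -
    define P where "P = (\<lambda>N. \<Sum>j<N. cscale (taylor_coeff f j) (\<lambda>z. z ^ j))"
    note sub = subspace_fock_closure[OF S]
    have P: "P N \<in> fock.mtopology closure_of S" for N
      unfolding P_def by (intro cfun.subspace_sum[OF sub] cfun.subspace_scale[OF sub] pow)
    have coeff: "taylor_coeff (P N) k = (if k < N then taylor_coeff f k else 0)" for N k
    proof -
      have "taylor_coeff (P N) k = (\<Sum>j<N. taylor_coeff f j * (if k = j then 1 else 0))"
        unfolding P_def
        by (subst taylor_coeff_sum)
           (auto simp: taylor_coeff_scale fock_holomorphic[OF fock_power] taylor_coeff_power
             intro!: fock_holomorphic fock_scale_closed fock_power sum.cong)
      also have "\<dots> = (\<Sum>j<N. if j = k then taylor_coeff f j else 0)"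
        by (intro sum.cong) auto
      finally show ?thesis by simp
    qed
    have "(\<lambda>N. fock_norm (f - P N)) \<longlonglongrightarrow> 0"
    proof (rule fock_tendsto_dominated[where F = f and B = 1])
      show "P N \<in> fock" for N using P[of N] by (simp add: fock_closure_iff)
      show "(\<lambda>N. taylor_coeff (P N) k) \<longlonglongrightarrow> taylor_coeff f k" for k
        by (rule tendsto_eventually) (auto simp: coeff eventually_at_top_linorder intro!: exI[of _ "Suc k"])
    qed (use f in \<open>auto simp: coeff\<close>)
    with P f show ?thesis by (rule fock_closure_sequence)
  qed
  then show ?thesis
    using S(2) by (auto simp: fock_dense_def fock_closure_iff)
qed

section \<open>Recovering monomials from dilated exponentials\<close>

text \<open>The case k = 2 excludes a = 0; cancelling in a^i = a^j with i < j then gives a^(j-i+1) =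
  a, with exponent at least 2.\<close>

lemma power_inj_if_no_power_fixed:
  fixes a :: complex
  assumes "\<forall>k\<ge>2::nat. a ^ k \<noteq> a" "a ^ i = a ^ j"
  shows "i = j"
proof -
  have a0: "a \<noteq> 0" using assms(1)[rule_format, of 2] by auto
  have aux: False if "i < j" "a ^ i = a ^ j" for i j
  proof -
    have "a ^ j = a ^ i * a ^ (j - i)" using that(1) by (simp flip: power_add)
    then have "a ^ (j - i) = 1" using that a0 by simp
    then have "a ^ Suc (j - i) = a" by simp
    moreover have "2 \<le> Suc (j - i)" using that(1) by linarith
    ultimately show False using assms(1) by blast
  qed
  then show ?thesis using assms(2) by (metis linorder_neqE_nat)
qed

text \<open>The geometric sums stay bounded by 2/|1-r| while the divisor grows.\<close>

lemma cesaro_power_tendsto: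
  fixes r :: complex
  assumes "cmod r = 1" "r \<noteq> 1"
  shows "(\<lambda>N. (\<Sum>n<Suc N. r ^ n) / of_nat (Suc N)) \<longlonglongrightarrow> 0"
proof (rule Lim_null_comparison[OF always_eventually])
  show "\<forall>N. cmod ((\<Sum>n<Suc N. r ^ n) / of_nat (Suc N)) \<le> 2 / cmod (1 - r) * inverse (real (Suc N))"
  proof
    fix N
    have le: "cmod (1 - r ^ Suc N) \<le> 2"
      using norm_triangle_ineq4[of 1 "r ^ Suc N"] by (simp only: norm_power assms) simp
    have "(\<Sum>n<Suc N. r ^ n) = (1 - r ^ Suc N) / (1 - r)"
      using geometric_sum[OF assms(2), of "Suc N"] assms(2) by (simp only: minus_divide_divide[of "r ^ Suc N - 1" "r - 1", symmetric]) simp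
    then have "cmod ((\<Sum>n<Suc N. r ^ n) / of_nat (Suc N))
        = cmod (1 - r ^ Suc N) / cmod (1 - r) * inverse (real (Suc N))"
      by (simp only: norm_divide norm_of_nat) (simp only: divide_inverse)
    also have "\<dots> \<le> 2 / cmod (1 - r) * inverse (real (Suc N))"
      using le by (intro mult_right_mono divide_right_mono) auto
    finally show "cmod ((\<Sum>n<Suc N. r ^ n) / of_nat (Suc N)) \<le> 2 / cmod (1 - r) * inverse (real (Suc N))" .
  qed
  show "(\<lambda>N. 2 / cmod (1 - r) * inverse (real (Suc N))) \<longlonglongrightarrow> 0"
    by (rule tendsto_mult_right_zero[OF LIMSEQ_inverse_real_of_nat])
qed

text \<open>For \<open>|a| < 1\<close> the monomials are split off one after the other, dividing the remaining
  tail by its leading power of \<open>a\<close>; for \<open>|a| = 1\<close> they are extracted by Cesaro averages.\<close>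

lemma powers_in_closure_dilated_exp:
  assumes S: "cfun.subspace S" "S \<subseteq> fock" and w: "w \<noteq> 0"
    and a: "cmod a \<le> 1" "\<forall>k\<ge>2::nat. a ^ k \<noteq> a"
    and exps: "\<And>n. (\<lambda>z. exp (w * (a ^ n * z))) \<in> S"
  shows "(\<lambda>z. z ^ k) \<in> fock.mtopology closure_of S"
proof -
  define h where "h = (\<lambda>n z. exp (w * (a ^ n * z)))"
  define c where "c = (\<lambda>j. w ^ j / fact j)"
  define cl where "cl = fock.mtopology closure_of S"
  note sub = subspace_fock_closure[OF S, folded cl_def]
  have a0: "a \<noteq> 0" using a(2)[rule_format, of 2] by auto
  have hS: "h n \<in> S" for n using exps[of n] by (simp add: h_def)
  have hF: "h n \<in> fock" for n using hS S(2) by blast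
  have hcl: "h n \<in> cl" for n
    unfolding cl_def using hS S(2) closure_of_subset[of S fock.mtopology] by auto
  have coeff_h: "taylor_coeff (h n) j = (a ^ n) ^ j * c j" for n j
    using taylor_coeff_exp[of "w * a ^ n" j] by (simp add: h_def c_def power_mult_distrib mult_ac)
  have coeff_F: "taylor_coeff (h 0) j = c j" for j by (simp add: coeff_h)
  have c0: "c j \<noteq> 0" for j using w by (simp add: c_def)
  have target: "taylor_coeff (cscale (c k) (\<lambda>z. z ^ k)) j = (if j = k then c k else 0)" for k j
    by (simp add: taylor_coeff_scale fock_holomorphic[OF fock_power] taylor_coeff_power)
  \<comment> \<open>Both cases only have to produce elements of the closure whose coefficients are
    dominated by those of \<open>h 0\<close> and converge to those of c_k z^k.\<close>
  have reduce: "(\<lambda>z. z ^ k) \<in> cl"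
    if g: "\<And>n. g n \<in> cl"
      and dom: "\<And>n j. cmod (taylor_coeff (g n) j) \<le> cmod (c j)"
      and lim: "\<And>j. (\<lambda>n. taylor_coeff (g n) j) \<longlonglongrightarrow> (if j = k then c k else 0)" for g k
  proof -
    have T: "cscale (c k) (\<lambda>z. z ^ k) \<in> fock" by (intro fock_scale_closed fock_power)
    have "(\<lambda>n. fock_norm (cscale (c k) (\<lambda>z. z ^ k) - g n)) \<longlonglongrightarrow> 0"
    proof (rule fock_tendsto_dominated[where F = "h 0" and B = 1])
      show "g n \<in> fock" for n using g[of n] by (simp add: cl_def fock_closure_iff)
    qed (use dom lim hF T in \<open>simp_all add: coeff_F target\<close>)
    then have "cscale (c k) (\<lambda>z. z ^ k) \<in> cl"
      unfolding cl_def by (rule fock_closure_sequence[OF g[unfolded cl_def] T])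
    then have "cscale (1 / c k) (cscale (c k) (\<lambda>z. z ^ k)) \<in> cl"
      by (rule cfun.subspace_scale[OF sub])
    then show ?thesis using c0[of k] by (simp add: cscale_def)
  qed
  have "(\<lambda>z. z ^ k) \<in> cl"
  proof (cases "cmod a = 1")
    case True
    \<comment> \<open>Division by a^(nk) makes the k-th coefficient independent of n; the j-th
      becomes c_j times the n-th power of a^j/a^k, which is unimodular and differs from 1 for j
      \<noteq> k, so averaging removes it.\<close>
    define g where "g = (\<lambda>N. cscale (1 / of_nat (Suc N)) (\<Sum>n<Suc N. cscale (1 / (a ^ n) ^ k) (h n)))"
    have coeff_g: "taylor_coeff (g N) j = c j * ((\<Sum>n<Suc N. (a ^ j / a ^ k) ^ n) / of_nat (Suc N))" for N j
    proof -
      have hol: "cscale (1 / (a ^ n) ^ k) (h n) holomorphic_on UNIV" for n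
        by (intro fock_holomorphic fock_scale_closed hF)
      have "taylor_coeff (g N) j = 1 / of_nat (Suc N) * (\<Sum>n<Suc N. 1 / (a ^ n) ^ k * ((a ^ n) ^ j * c j))"
        unfolding g_def
        by (subst taylor_coeff_scale, rule holomorphic_sum_UNIV, rule hol, subst taylor_coeff_sum, rule hol)
           (simp only: taylor_coeff_scale[OF fock_holomorphic[OF hF]] coeff_h)
      also have "(\<Sum>n<Suc N. 1 / (a ^ n) ^ k * ((a ^ n) ^ j * c j)) = c j * (\<Sum>n<Suc N. (a ^ j / a ^ k) ^ n)"
        unfolding sum_distrib_left
        by (intro sum.cong refl) (simp add: power_divide mult.commute flip: power_mult)
      finally show ?thesis by simp
    qed
    have r1: "cmod (a ^ j / a ^ k) = 1" for j using True by (simp add: norm_divide norm_power)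
    show ?thesis
    proof (rule reduce[of g])
      show "g N \<in> cl" for N
        unfolding g_def by (intro cfun.subspace_scale[OF sub] cfun.subspace_sum[OF sub] hcl)
      show "cmod (taylor_coeff (g N) j) \<le> cmod (c j)" for N j
      proof -
        have "cmod (\<Sum>n<Suc N. (a ^ j / a ^ k) ^ n) \<le> (\<Sum>n<Suc N. 1)"
          by (intro sum_norm_le) (simp only: norm_power r1 power_one order_refl)
        then have "cmod ((\<Sum>n<Suc N. (a ^ j / a ^ k) ^ n) / of_nat (Suc N)) \<le> 1"
          by (simp add: norm_divide del: sum.lessThan_Suc of_nat_Suc)
        then show ?thesis
          unfolding coeff_g norm_mult by (rule mult_left_le) simp
      qed
      show "(\<lambda>N. taylor_coeff (g N) j) \<longlonglongrightarrow> (if j = k then c k else 0)" for j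
      proof (cases "j = k")
        case True
        have "(\<Sum>n<Suc N. (a ^ k / a ^ k) ^ n) / of_nat (Suc N) = (1 :: complex)" for N
          using a0 by (simp del: sum.lessThan_Suc of_nat_Suc)
        then show ?thesis unfolding coeff_g True by (simp only:) simp
      next
        case False
        then have "a ^ j / a ^ k \<noteq> 1"
          using power_inj_if_no_power_fixed[OF a(2), of j k] a0 by auto
        then have "(\<lambda>N. c j * ((\<Sum>n<Suc N. (a ^ j / a ^ k) ^ n) / of_nat (Suc N))) \<longlonglongrightarrow> 0"
          by (rule tendsto_mult_right_zero[OF cesaro_power_tendsto[OF r1]])
        then show ?thesis by (simp only: coeff_g False if_False)
      qed
    qed
  next
    case False
    then have a1: "cmod a < 1" using a by simp
    show ?thesis
    proof (induction k rule: less_induct)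
      case (less k)
      \<comment> \<open>The subtracted monomials lie in the closure by induction. After division the
        k-th coefficient is c_k, and the higher ones carry the factor a^((j-k)n), which tends to
        0.\<close>
      define g where "g = (\<lambda>n. cscale (1 / (a ^ n) ^ k)
        (h n - (\<Sum>i<k. cscale ((a ^ n) ^ i * c i) (\<lambda>z. z ^ i))))"
      have coeff_g: "taylor_coeff (g n) j = (if j < k then 0 else (a ^ (j - k)) ^ n * c j)" for n j
      proof -
        have hol: "cscale b (\<lambda>z. z ^ i) holomorphic_on UNIV" for b i
          by (intro fock_holomorphic fock_scale_closed fock_power)
        have "taylor_coeff (\<Sum>i<k. cscale ((a ^ n) ^ i * c i) (\<lambda>z. z ^ i)) j
            = (\<Sum>i<k. (a ^ n) ^ i * c i * (if j = i then 1 else 0))"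
          by (subst taylor_coeff_sum, rule hol)
             (simp only: taylor_coeff_scale[OF fock_holomorphic[OF fock_power]] taylor_coeff_power)
        also have "\<dots> = (\<Sum>i<k. if i = j then (a ^ n) ^ i * c i else 0)"
          by (intro sum.cong) auto
        also have "\<dots> = (if j < k then (a ^ n) ^ j * c j else 0)" by simp
        finally have s: "taylor_coeff (\<Sum>i<k. cscale ((a ^ n) ^ i * c i) (\<lambda>z. z ^ i)) j
            = (if j < k then (a ^ n) ^ j * c j else 0)" .
        have hs: "(\<Sum>i<k. cscale ((a ^ n) ^ i * c i) (\<lambda>z. z ^ i)) holomorphic_on UNIV"
          by (rule holomorphic_sum_UNIV) (rule hol)
        have hd: "h n - (\<Sum>i<k. cscale ((a ^ n) ^ i * c i) (\<lambda>z. z ^ i)) holomorphic_on UNIV"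
          using holomorphic_on_diff[OF fock_holomorphic[OF hF] hs] by (simp add: fun_diff_def)
        have "taylor_coeff (g n) j = 1 / (a ^ n) ^ k * ((a ^ n) ^ j * c j - (if j < k then (a ^ n) ^ j * c j else 0))"
          unfolding g_def taylor_coeff_scale[OF hd] taylor_coeff_diff[OF fock_holomorphic[OF hF] hs] s coeff_h ..
        also have "\<dots> = (if j < k then 0 else (a ^ (j - k)) ^ n * c j)"
        proof (cases "j < k")
          case False
          then have "(a ^ n) ^ j = (a ^ n) ^ k * (a ^ (j - k)) ^ n"
            by (simp add: power_add[symmetric] flip: power_mult) (simp add: algebra_simps flip: power_add)
          then show ?thesis using False a0 by simp
        qed simp
        finally show ?thesis .
      qed
      show ?case
      proof (rule reduce[of g])
        show "g n \<in> cl" for n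
          unfolding g_def
          by (intro cfun.subspace_scale[OF sub] cfun.subspace_diff[OF sub] cfun.subspace_sum[OF sub] hcl less.IH) simp
        show "cmod (taylor_coeff (g n) j) \<le> cmod (c j)" for n j
          using a by (auto simp: coeff_g norm_mult norm_power power_le_one mult_left_le_one_le)
        show "(\<lambda>n. taylor_coeff (g n) j) \<longlonglongrightarrow> (if j = k then c k else 0)" for j
        proof (cases "j \<le> k")
          case True
          then show ?thesis by (auto simp: coeff_g)
        next
          case False
          then have "cmod (a ^ (j - k)) < 1"
            using a1 by (simp add: norm_power power_less_one_iff)
          then have "(\<lambda>n. (a ^ (j - k)) ^ n) \<longlonglongrightarrow> 0" by (rule LIMSEQ_power_zero)
          then have "(\<lambda>n. (a ^ (j - k)) ^ n * c j) \<longlonglongrightarrow> 0" by (rule tendsto_mult_left_zero)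
          then show ?thesis using False by (simp add: coeff_g)
        qed
      qed
    qed
  qed
  then show ?thesis by (simp add: cl_def)
qed

lemma orbit_in_fock:
  assumes "fock_bounded T" "f \<in> fock"
  shows "(T ^^ n) f \<in> fock"
proof (induction n)
  case (Suc n)
  then show ?case using assms(1) by (auto simp: fock_bounded_def)
qed (simp add: assms)

text \<open>The kernel at 0 is the constant 1, which every composition operator fixes; hence z
  \<noteq> 0.\<close>

lemma cyclic_vector_kernel:
  assumes a: "cmod a \<le> 1" "cmod a = 1 \<longrightarrow> b = 0" "\<forall>k\<ge>2::nat. a ^ k \<noteq> a" and z: "z \<noteq> 0"
  shows "cyclic_vector (comp_op (\<lambda>z. a * z + b)) (fock_kernel z)"
proof -
  define T where "T = comp_op (\<lambda>z. a * z + b)"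
  define S where "S = cfun.span (range (\<lambda>n. (T ^^ n) (fock_kernel z)))"
  obtain p where p: "a * p + b = p" using affine_fixed_point_exists[OF a(1,2)] .
  have bdd: "fock_bounded T" unfolding T_def by (rule fock_bounded_comp_op_affine[OF a(1,2)])
  have S: "cfun.subspace S" "S \<subseteq> fock"
    unfolding S_def using orbit_in_fock[OF bdd fock_kernel_in_fock]
    by (auto intro!: cfun.subspace_span dest!: subsetD[OF cfun.span_minimal[OF _ fock_subspace], rotated])
  have "(\<lambda>w. exp (cnj z * (a ^ n * w))) \<in> S" for n
  proof -
    \<comment> \<open>\<open>e\<close> cancels the factor of the n-th orbit element that comes from
      the fixed point p and does not depend on w.\<close>
    define e where "e = exp (- ((p - a ^ n * p) * cnj z))"
    have "(T ^^ n) (fock_kernel z) = (\<lambda>w. exp ((p + a ^ n * (w - p)) * cnj z))"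
      by (simp only: T_def comp_op_funpow affine_funpow_fixed_point[OF p] fock_kernel_def)
    then have "cscale e ((T ^^ n) (fock_kernel z)) = (\<lambda>w. exp (cnj z * (a ^ n * w)))"
      by (simp add: e_def cscale_def exp_add[symmetric] algebra_simps)
    moreover have "cscale e ((T ^^ n) (fock_kernel z)) \<in> S"
      unfolding S_def by (intro cfun.span_scale cfun.span_base) simp
    ultimately show ?thesis by simp
  qed
  then have "fock_dense S"
    using z by (intro fock_dense_if_powers S powers_in_closure_dilated_exp[where w = "cnj z" and a = a, OF S _ a(1,3)]) auto
  then show ?thesis
    by (simp add: cyclic_vector_def fock_kernel_in_fock S_def T_def)
qed

text \<open>The functionals \<open>taylor_coeff _ 1\<close> and \<open>taylor_coeff _ k\<close> are eigenvectors of the adjoint for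
  the same eigenvalue \<open>a = a ^ k\<close>, so every linear relation between them at \<open>f\<close> persists on the orbit.\<close>

lemma not_cyclic_comp_op:
  assumes a: "cmod a \<le> 1" "cmod a = 1 \<longrightarrow> b = 0" and k: "k \<ge> 2" "a ^ k = a"
  shows "\<not> cyclic (comp_op (\<lambda>z. a * z + b))"
proof
  define T where "T = comp_op (\<lambda>z. a * z + b)"
  assume "cyclic (comp_op (\<lambda>z. a * z + b))"
  then obtain f where f: "f \<in> fock" and dense: "fock_dense (cfun.span (range (\<lambda>n. (T ^^ n) f)))"
    by (auto simp: cyclic_def cyclic_vector_def T_def)
  have bdd: "fock_bounded T" unfolding T_def by (rule fock_bounded_comp_op_affine[OF a])
  have coeff_T: "taylor_coeff (T g) j = a * taylor_coeff g j" if g: "g \<in> fock" and j: "j = 1 \<or> j = k" for g j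
  proof (cases "b = 0")
    case True
    have "a ^ j = a" using j k by auto
    then show ?thesis
      using taylor_coeff_dilate[OF fock_holomorphic[OF g], of a j] True
      by (simp add: T_def comp_op_def o_def)
  next
    case False
    \<comment> \<open>With b \<noteq> 0 a nonzero \<open>a\<close> would be a root of unity,
      contradicting the condition on \<open>b\<close>. For a = 0 the image is a constant, whose
      coefficients of orders 1 and k vanish.\<close>
    have "a = 0"
    proof (rule ccontr)
      assume "a \<noteq> 0"
      have "a * a ^ (k - 1) = a * 1" using k by (simp add: power_eq_if)
      then have "a ^ (k - 1) = 1" using \<open>a \<noteq> 0\<close> by simp
      then have "cmod a ^ (k - 1) = 1" by (metis norm_one norm_power)
      then have "cmod a = 1" using k(1) by (intro power_eq_imp_eq_base[of "cmod a" "k - 1" 1]) auto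
      then show False using a(2) False by simp
    qed
    then show ?thesis using j k(1) taylor_coeff_const[of "g b" j] by (auto simp: T_def comp_op_def o_def)
  qed
  have coeff_orbit: "taylor_coeff ((T ^^ n) f) j = a ^ n * taylor_coeff f j" if "j = 1 \<or> j = k" for n j
    by (induction n) (simp_all add: coeff_T[OF orbit_in_fock[OF bdd f] that])
  have relation: "A * taylor_coeff g 1 = B * taylor_coeff g k"
    if AB: "A * taylor_coeff f 1 = B * taylor_coeff f k" and g: "g \<in> fock" for A B g
  proof (rule taylor_coeff_relation_dense[OF dense _ g])
    \<comment> \<open>Holomorphy belongs to \<open>R\<close> because additivity and homogeneity of
      \<open>taylor_coeff\<close> are available for holomorphic functions.\<close>
    define R where "R = {g. g holomorphic_on UNIV \<and> A * taylor_coeff g 1 = B * taylor_coeff g k}"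
    have "cfun.subspace R"
    proof -
      have "0 \<in> R"
        using taylor_coeff_const[of 0] by (simp add: R_def zero_fun_def)
      moreover have "g + h \<in> R" if "g \<in> R" "h \<in> R" for g h
      proof -
        have "(g + h) holomorphic_on UNIV"
          using that holomorphic_on_add[of g UNIV h] by (simp add: R_def plus_fun_def)
        with that show ?thesis
          unfolding R_def mem_Collect_eq by (simp only: taylor_coeff_add distrib_left)
      qed
      moreover have "cscale c g \<in> R" if "g \<in> R" for c g
      proof -
        have "cscale c g holomorphic_on UNIV"
          using that by (auto simp: R_def cscale_def intro: holomorphic_intros)
        with that show ?thesis
          unfolding R_def mem_Collect_eq by (simp only: taylor_coeff_scale mult.left_commute[of _ c])
      qed
      ultimately show ?thesis by (simp add: cfun.subspace_def)
    qed
    moreover have "(T ^^ n) f \<in> R" for n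
      using AB fock_holomorphic[OF orbit_in_fock[OF bdd f, of n]]
      by (simp add: R_def coeff_orbit mult.left_commute)
    ultimately have "cfun.span (range (\<lambda>n. (T ^^ n) f)) \<subseteq> R"
      by (intro cfun.span_minimal) auto
    then show "A * taylor_coeff g 1 = B * taylor_coeff g k" if "g \<in> cfun.span (range (\<lambda>n. (T ^^ n) f))" for g
      using that by (auto simp: R_def)
  qed
  \<comment> \<open>This choice of coefficients makes the relation at \<open>f\<close> mere
    commutativity. Testing it on z^k forces the first coefficient of \<open>f\<close> to vanish;
    then the relation with coefficients 1 and 0 fails on z.\<close>
  have rel: "taylor_coeff f k * taylor_coeff g 1 = taylor_coeff f 1 * taylor_coeff g k" if "g \<in> fock" for g
    by (rule relation[OF mult.commute that])
  have "taylor_coeff f 1 = 0"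
    using rel[OF fock_power[of k]] k(1) by (simp add: taylor_coeff_power)
  then have "1 * taylor_coeff f 1 = 0 * taylor_coeff f k"
    by simp
  then have "1 * taylor_coeff (\<lambda>z. z ^ 1) 1 = 0 * taylor_coeff (\<lambda>z. z ^ 1) k"
    by (rule relation[OF _ fock_power])
  then show False by (simp only: taylor_coeff_power) simp
qed

theorem corollary2p3:
  shows
  "(\<forall>\<psi>. \<psi> holomorphic_on UNIV \<longrightarrow>
      (fock_bounded (comp_op \<psi>) \<longleftrightarrow>
        (\<exists>a b. \<psi> = (\<lambda>z. a * z + b) \<and> cmod a \<le> 1 \<and> (cmod a = 1 \<longrightarrow> b = 0))) \<and>
      (\<forall>a b. fock_bounded (comp_op \<psi>) \<longrightarrow> \<psi> = (\<lambda>z. a * z + b) \<longrightarrow>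
        (cyclic (comp_op \<psi>) \<longleftrightarrow> (\<forall>k\<ge>2::nat. a ^ k \<noteq> a)) \<and>
        (cyclic (comp_op \<psi>) \<longrightarrow> (\<forall>z. z \<noteq> 0 \<longrightarrow> cyclic_vector (comp_op \<psi>) (fock_kernel z))))) \<and>
   (\<forall>\<psi>. \<psi> holomorphic_on UNIV \<longrightarrow> fock_bounded (comp_op \<psi>) \<longrightarrow>
      \<not> supercyclic (comp_op \<psi>)) \<and>
   (\<forall>u. u holomorphic_on UNIV \<longrightarrow> fock_bounded (mult_op u) \<longrightarrow> \<not> cyclic (mult_op u))"
proof (intro conjI allI impI)
  fix \<psi> :: "complex \<Rightarrow> complex" assume hol: "\<psi> holomorphic_on UNIV"
  show "fock_bounded (comp_op \<psi>) \<longleftrightarrow>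
        (\<exists>a b. \<psi> = (\<lambda>z. a * z + b) \<and> cmod a \<le> 1 \<and> (cmod a = 1 \<longrightarrow> b = 0))"
    using fock_bounded_comp_op_affine fock_bounded_comp_op_imp_affine[OF hol] by metis
  assume bdd: "fock_bounded (comp_op \<psi>)"
  obtain a' b' where \<psi>: "\<psi> = (\<lambda>z. a' * z + b')" "cmod a' \<le> 1" "cmod a' = 1 \<longrightarrow> b' = 0"
    using fock_bounded_comp_op_imp_affine[OF hol bdd] .
  show "\<not> supercyclic (comp_op \<psi>)"
    unfolding \<psi>(1) by (rule not_supercyclic_comp_op[OF \<psi>(2,3)])
  fix a b assume ab: "\<psi> = (\<lambda>z. a * z + b)"
  \<comment> \<open>The values at 0 and 1 identify the given affine form with the one whose bounds
    were derived from boundedness.\<close>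
  have eq: "a' = a" "b' = b"
    using fun_cong[OF \<psi>(1)[unfolded ab], of 0] fun_cong[OF \<psi>(1)[unfolded ab], of 1] by simp_all
  note vec = cyclic_vector_kernel[OF \<psi>(2,3)[unfolded eq], folded ab]
  note not_cyclic = not_cyclic_comp_op[OF \<psi>(2,3)[unfolded eq], folded ab]
  show *: "cyclic (comp_op \<psi>) \<longleftrightarrow> (\<forall>k\<ge>2::nat. a ^ k \<noteq> a)"
    using vec[of 1] not_cyclic by (auto simp: cyclic_def)
  show "cyclic_vector (comp_op \<psi>) (fock_kernel z)" if "cyclic (comp_op \<psi>)" "z \<noteq> 0" for z
    using vec that * by blast
qed (use not_cyclic_mult_op in blast)

end
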